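(* Let $\Pi=\mathbb{R}/\mathbb{Z}$ be the circle and let $a\in C^2(\Pi)$ with $a>0$ (the drift $b$ being identically $0$). Then for every probability measure $\mu$ on $\Pi$, $$J(\mu)=0.$$
   Context: For $c\in C^0(\Pi)$ and $\epsilon>0$, let $\lambda_\epsilon^c$ be the principal eigenvalue (the eigenvalue with maximal real part) of the operator $u\mapsto\epsilon\,a\,u''+c\,u$ on $\Pi$. Let $\Lambda(c):=\lim_{\epsilon\to0}\lambda_\epsilon^c$ (this limit exists under the present assumptions). For a probability measure $\mu$ on $\Pi$, $$J(\mu):=\sup_{c\in C^0(\Pi)}\Bigl\{\int_\Pi c\,d\mu-\Lambda(c)\Bigr\}.$$ *)

theory Defs
  imports "HOL-Probability.Probability"
begin

definition circle_rel :: "real \<Rightarrow> real \<Rightarrow> bool" where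
  "circle_rel x y \<longleftrightarrow> x - y \<in> \<int>"

lemma equivp_circle_rel: "equivp circle_rel"
proof (rule equivpI)
  show "reflp circle_rel"
    by (simp add: reflp_def circle_rel_def)
  show "symp circle_rel"
    unfolding symp_def circle_rel_def by (metis Ints_minus minus_diff_eq)
  show "transp circle_rel"
    unfolding transp_def circle_rel_def by (metis Ints_add diff_add_cancel add_diff_eq)
qed

quotient_type circle = real / circle_rel
  morphisms rep_circle circle_of
  by (rule equivp_circle_rel)

text \<open>The circle carries the quotient topology; \<open>borel :: circle measure\<close> is the
  Borel \<open>\<sigma>\<close>-algebra of this topology.\<close>

instantiation circle :: topological_space
begin

definition open_circle :: "circle set \<Rightarrow> bool" where
  "open_circle U \<longleftrightarrow> open (circle_of -` U)"

instance
proof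
  show "open (UNIV :: circle set)"
    by (simp add: open_circle_def)
next
  fix S T :: "circle set"
  assume "open S" "open T"
  then show "open (S \<inter> T)"
    by (simp add: open_circle_def open_Int)
next
  fix K :: "circle set set"
  assume "\<forall>S\<in>K. open S"
  then show "open (\<Union>K)"
    by (auto simp: open_circle_def vimage_Union)
qed

end

lemma circle_of_eq_iff: "circle_of x = circle_of y \<longleftrightarrow> x - y \<in> \<int>"
  using circle.abs_eq_iff by (simp add: circle_rel_def)

lemma continuous_on_circle_iff:
  fixes f :: "circle \<Rightarrow> 'a::topological_space"
  shows "continuous_on UNIV f \<longleftrightarrow> continuous_on UNIV (\<lambda>t. f (circle_of t))"
  by (simp add: continuous_on_open_vimage open_circle_def vimage_def)

text \<open>Derivatives on the circle are taken in the coordinate \<open>t\<close>, i.e.\ for the lift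
  \<open>t \<mapsto> f (circle_of t)\<close> to the real line.\<close>

definition has_circle_derivative ::
    "(circle \<Rightarrow> 'a::real_normed_vector) \<Rightarrow> (circle \<Rightarrow> 'a) \<Rightarrow> bool" where
  "has_circle_derivative f f' \<longleftrightarrow>
     (\<forall>t. ((\<lambda>s. f (circle_of s)) has_vector_derivative f' (circle_of t)) (at t))"

definition has_C2_derivatives ::
    "(circle \<Rightarrow> 'a::real_normed_vector) \<Rightarrow> (circle \<Rightarrow> 'a) \<Rightarrow> (circle \<Rightarrow> 'a) \<Rightarrow> bool" where
  "has_C2_derivatives f f' f'' \<longleftrightarrow>
     has_circle_derivative f f' \<and> has_circle_derivative f' f'' \<and> continuous_on UNIV f''"

definition C2_circle :: "(circle \<Rightarrow> 'a::real_normed_vector) \<Rightarrow> bool" where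
  "C2_circle f \<longleftrightarrow> (\<exists>f' f''. has_C2_derivatives f f' f'')"

text \<open>Eigenvalues of \<open>u \<mapsto> \<epsilon> a u'' + c u\<close> are complex, with complex-valued classical
  eigenfunctions. As \<open>\<epsilon> a\<close> is positive and continuous and \<open>c\<close> is continuous, a weak
  (\<open>H\<^sup>2\<close>) eigenfunction is automatically \<open>C\<^sup>2\<close>.\<close>

definition is_eigenvalue ::
    "(circle \<Rightarrow> real) \<Rightarrow> (circle \<Rightarrow> real) \<Rightarrow> real \<Rightarrow> complex \<Rightarrow> bool" where
  "is_eigenvalue a c \<epsilon> z \<longleftrightarrow>
     (\<exists>u u' u''. has_C2_derivatives u u' u'' \<and> (\<exists>p. u p \<noteq> 0) \<and>
        (\<forall>p. complex_of_real (\<epsilon> * a p) * u'' p + complex_of_real (c p) * u p = z * u p))"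

definition principal_eigenvalue ::
    "(circle \<Rightarrow> real) \<Rightarrow> (circle \<Rightarrow> real) \<Rightarrow> real \<Rightarrow> complex" where
  "principal_eigenvalue a c \<epsilon> =
     (THE z. is_eigenvalue a c \<epsilon> z \<and> (\<forall>w. is_eigenvalue a c \<epsilon> w \<longrightarrow> Re w \<le> Re z))"

text \<open>The principal eigenvalue is real, so taking its real part only adjusts the type.\<close>

definition Lambda :: "(circle \<Rightarrow> real) \<Rightarrow> (circle \<Rightarrow> real) \<Rightarrow> real" where
  "Lambda a c = Lim (at_right 0) (\<lambda>\<epsilon>. Re (principal_eigenvalue a c \<epsilon>))"

text \<open>The supremum is taken in the extended reals, so that it is a genuine supremum even
  where it might be infinite.\<close>

definition J :: "(circle \<Rightarrow> real) \<Rightarrow> circle measure \<Rightarrow> ereal" where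
  "J a \<mu> = (SUP c\<in>{c. continuous_on UNIV c}. ereal ((\<integral>p. c p \<partial>\<mu>) - Lambda a c))"

end

theory Submission
  imports Defs
begin

text \<open>Since \<open>b = 0\<close>, one has \<open>\<Lambda>(c) = max c\<close>. As \<open>\<mu>\<close> is a probability
  measure this gives \<open>\<integral>c d\<mu> \<le> \<Lambda>(c)\<close>, with equality for \<open>c = 0\<close>.

  In the coordinate \<open>t\<close> the eigenvalue equation is Hill's equation \<open>u'' = (\<kappa> r - s) u\<close> with
  \<open>r = 1 / (\<epsilon> a)\<close> and \<open>s = c / (\<epsilon> a)\<close>. It is self-adjoint for the weight \<open>r\<close>, so the eigenvalues
  are real, and they are the solutions of \<open>D \<kappa> = 2\<close>, where \<open>D\<close> is the trace of the monodromy matrix.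
  None exceeds \<open>m = max c\<close>, and \<open>D m \<ge> 2\<close>. If \<open>c \<ge> m - \<delta>/2\<close> on an interval, Sturm comparison
  with a sine shows that for small \<open>\<epsilon>\<close> the solution \<open>\<psi>\<close> with Dirichlet data at \<open>0\<close> has a zero in
  \<open>(0, 1]\<close> at \<open>\<kappa> = m - \<delta>\<close>. The largest \<open>\<kappa>\<close> with this property is a Dirichlet eigenvalue,
  for which \<open>D \<kappa> < 0\<close>. By continuity of \<open>D\<close> there is a greatest eigenvalue, and it lies in
  \<open>[m - \<delta>, m]\<close>.\<close>

section \<open>Linear equations of second order\<close>

lemma antiderivative_real:
  fixes f :: "real \<Rightarrow> real"
  assumes "continuous_on UNIV f"
  obtains F where "F 0 = 0" "\<And>t. (F has_real_derivative f t) (at t)"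
proof -
  have "\<exists>F. \<forall>x. -\<infinity> < ereal x \<longrightarrow> ereal x < \<infinity> \<longrightarrow> (F has_vector_derivative f x) (at x)"
    using assms by (intro einterval_antiderivative) (auto simp: continuous_on_eq_continuous_at)
  then obtain F where F: "\<And>x. (F has_real_derivative f x) (at x)"
    by (auto simp: has_real_derivative_iff_has_vector_derivative)
  have "((\<lambda>t. F t - F 0) has_real_derivative f t) (at t)" for t
    using F[of t] by (auto intro!: derivative_eq_intros)
  then show ?thesis using that[of "\<lambda>t. F t - F 0"] by simp
qed

text \<open>Both \<open>C * t ^ Suc n / Suc n - F t\<close> and the same expression with
  \<open>+ F t\<close> start at 0 and have nonnegative derivative.\<close>

lemma antiderivative_power_bound_pos:
  fixes F f :: "real \<Rightarrow> real"
  assumes F0: "F 0 = 0" and dF: "\<And>t. (F has_real_derivative f t) (at t)"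
    and b: "\<And>t. t \<ge> 0 \<Longrightarrow> \<bar>f t\<bar> \<le> C * t ^ n" and t: "t \<ge> 0"
  shows "\<bar>F t\<bar> \<le> C * t ^ Suc n / Suc n"
proof -
  have d: "((\<lambda>t. C * t ^ Suc n / Suc n) has_real_derivative C * x ^ n) (at x)" for x
    by (auto intro!: derivative_eq_intros simp del: power_Suc)
  have "C * 0 ^ Suc n / Suc n - F 0 \<le> C * t ^ Suc n / Suc n - F t"
  proof (rule DERIV_nonneg_imp_nondecreasing[OF t])
    fix x assume "0 \<le> x" "x \<le> t"
    then show "\<exists>y. ((\<lambda>t. C * t ^ Suc n / Suc n - F t) has_real_derivative y) (at x) \<and> 0 \<le> y"
      using DERIV_diff[OF d[of x] dF[of x]] b[of x] by (intro exI[of _ "C * x ^ n - f x"]) auto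
  qed
  moreover have "C * 0 ^ Suc n / Suc n + F 0 \<le> C * t ^ Suc n / Suc n + F t"
  proof (rule DERIV_nonneg_imp_nondecreasing[OF t])
    fix x assume "0 \<le> x" "x \<le> t"
    then show "\<exists>y. ((\<lambda>t. C * t ^ Suc n / Suc n + F t) has_real_derivative y) (at x) \<and> 0 \<le> y"
      using DERIV_add[OF d[of x] dF[of x]] b[of x] by (intro exI[of _ "C * x ^ n + f x"]) auto
  qed
  ultimately show ?thesis using F0 by (auto simp: abs_le_iff)
qed

text \<open>The basic estimate of the Picard iteration: each integration raises the power by one and
  divides by \<open>Suc n\<close>, which builds up the factorial. Negative t are handled by
  reflection.\<close>

lemma antiderivative_power_bound:
  fixes F f :: "real \<Rightarrow> real"
  assumes F0: "F 0 = 0" and dF: "\<And>t. (F has_real_derivative f t) (at t)"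
    and b: "\<And>t. \<bar>f t\<bar> \<le> C * \<bar>t\<bar> ^ n"
  shows "\<bar>F t\<bar> \<le> C * \<bar>t\<bar> ^ Suc n / Suc n"
proof (cases "t \<ge> 0")
  case True
  have "\<bar>F t\<bar> \<le> C * t ^ Suc n / Suc n"
  proof (rule antiderivative_power_bound_pos[OF F0 dF _ True])
    show "\<bar>f x\<bar> \<le> C * x ^ n" if "x \<ge> 0" for x using b[of x] that by simp
  qed
  with True show ?thesis by simp
next
  case False
  have "\<bar>F (- (- t))\<bar> \<le> C * (- t) ^ Suc n / Suc n"
  proof (rule antiderivative_power_bound_pos[where f = "\<lambda>t. - f (- t)"])
    show "((\<lambda>t. F (- t)) has_real_derivative - f (- x)) (at x)" for x
      using DERIV_chain2[OF dF[of "- x"] DERIV_minus[OF DERIV_ident]] by simp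
    show "\<bar>- f (- x)\<bar> \<le> C * x ^ n" if "x \<ge> 0" for x using b[of "- x"] that by simp
  qed (use F0 False in auto)
  with False show ?thesis by simp
qed

text \<open>The equation u'' = q u as a first order system: carrying v = u' explicitly makes Cauchy
  data, Wronskians and phase plane distances statements about the pair.\<close>

definition ode_sol :: "(real \<Rightarrow> real) \<Rightarrow> (real \<Rightarrow> real) \<Rightarrow> (real \<Rightarrow> real) \<Rightarrow> bool" where
  "ode_sol q u v \<longleftrightarrow> (\<forall>t. (u has_real_derivative v t) (at t) \<and>
     (v has_real_derivative q t * u t) (at t))"

text \<open>The solution is the sum of all Picard increments. Their factorial bound makes the series
  and its termwise derivative converge locally uniformly on the whole line, since q is
  bounded.\<close>

lemma ode_sol_exists:
  fixes q :: "real \<Rightarrow> real"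
  assumes q: "continuous_on UNIV q" and bd: "\<And>t. \<bar>q t\<bar> \<le> Q"
  shows "\<exists>u v. ode_sol q u v \<and> u 0 = \<alpha> \<and> v 0 = \<beta>"
proof -
  define A where "A f = (SOME F. F 0 = 0 \<and> (\<forall>t. (F has_real_derivative f t) (at t)))"
    for f :: "real \<Rightarrow> real"
  have A: "A f 0 = 0 \<and> (\<forall>t. (A f has_real_derivative f t) (at t))" if f: "continuous_on UNIV f" for f
  proof -
    obtain F where "F 0 = 0" "\<And>t. (F has_real_derivative f t) (at t)"
      using antiderivative_real[OF f] by blast
    then show ?thesis unfolding A_def
      by (intro someI[of "\<lambda>F. F 0 = 0 \<and> (\<forall>t. (F has_real_derivative f t) (at t))"]) auto
  qed
  \<comment> \<open>Picard iteration for the increments of the pair \<open>(u, v)\<close>\<close>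
  define y where "y = rec_nat (\<lambda>_::real. \<alpha>, \<lambda>_::real. \<beta>) (\<lambda>_ p. (A (snd p), A (\<lambda>t. q t * fst p t)))"
  define f g where "f n = fst (y n)" and "g n = snd (y n)" for n
  have f0: "f 0 = (\<lambda>_. \<alpha>)" and g0: "g 0 = (\<lambda>_. \<beta>)"
    and fS: "f (Suc n) = A (g n)" and gS: "g (Suc n) = A (\<lambda>t. q t * f n t)" for n
    by (simp_all add: f_def g_def y_def)
  have cont: "continuous_on UNIV (f n) \<and> continuous_on UNIV (g n)" for n
  proof (induction n)
    case 0
    then show ?case by (simp add: f0 g0)
  next
    case (Suc n)
    have "continuous_on UNIV (\<lambda>t. q t * f n t)" using Suc q by (intro continuous_intros) auto
    then show ?case using Suc A unfolding fS gS
      by (meson DERIV_isCont continuous_at_imp_continuous_on)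
  qed
  have df: "f (Suc n) 0 = 0" "(f (Suc n) has_real_derivative g n t) (at t)" for n t
    using A[of "g n"] cont[of n] by (auto simp: fS)
  have dg: "g (Suc n) 0 = 0" "(g (Suc n) has_real_derivative q t * f n t) (at t)" for n t
    using A[of "\<lambda>t. q t * f n t"] cont[of n] q by (auto simp: gS intro!: continuous_intros)
  \<comment> \<open>One constant dominates the coefficients of both equations: 1 in u' = v and q in
    v' = q u.\<close>
  define K where "K = max 1 Q"
  define B where "B = max \<bar>\<alpha>\<bar> \<bar>\<beta>\<bar>"
  have K: "K \<ge> 1" "K \<ge> Q" "B \<ge> 0" by (auto simp: K_def B_def)
  have bound: "(\<forall>t. \<bar>f n t\<bar> \<le> B * K ^ n / fact n * \<bar>t\<bar> ^ n) \<and> (\<forall>t. \<bar>g n t\<bar> \<le> B * K ^ n / fact n * \<bar>t\<bar> ^ n)" for n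
  proof (induction n)
    case 0
    then show ?case by (simp add: f0 g0 B_def)
  next
    case (Suc n)
    define C where "C = B * K ^ n / fact n"
    have C0: "C \<ge> 0" using K by (simp add: C_def)
    have eq: "B * K ^ Suc n / fact (Suc n) * x = K * C * x / Suc n" for x
      by (simp add: C_def field_simps)
    have "\<bar>g n t\<bar> \<le> K * C * \<bar>t\<bar> ^ n" for t
    proof -
      have "\<bar>g n t\<bar> \<le> 1 * (C * \<bar>t\<bar> ^ n)" using Suc by (auto simp: C_def)
      also have "\<dots> \<le> K * (C * \<bar>t\<bar> ^ n)" using K C0 by (intro mult_right_mono) auto
      finally show ?thesis by (simp add: mult.assoc)
    qed
    then have "\<bar>f (Suc n) t\<bar> \<le> K * C * \<bar>t\<bar> ^ Suc n / Suc n" for t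
      by (rule antiderivative_power_bound[OF df])
    moreover have "\<bar>q t * f n t\<bar> \<le> K * C * \<bar>t\<bar> ^ n" for t
    proof -
      have "\<bar>q t * f n t\<bar> \<le> K * (C * \<bar>t\<bar> ^ n)"
        unfolding abs_mult using Suc K bd[of t] by (intro mult_mono) (auto simp: C_def)
      then show ?thesis by (simp add: mult.assoc)
    qed
    then have "\<bar>g (Suc n) t\<bar> \<le> K * C * \<bar>t\<bar> ^ Suc n / Suc n" for t
      by (rule antiderivative_power_bound[OF dg])
    ultimately show ?case by (simp only: eq) simp
  qed
  have unif: "norm (f n t) \<le> B * ((K * N) ^ n /\<^sub>R fact n) \<and> norm (g n t) \<le> B * ((K * N) ^ n /\<^sub>R fact n)" if "\<bar>t\<bar> \<le> N" for n t N
  proof -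
    have "B * K ^ n / fact n * \<bar>t\<bar> ^ n \<le> B * K ^ n / fact n * N ^ n"
      using K that by (intro mult_left_mono power_mono) auto
    also have "\<dots> = B * ((K * N) ^ n /\<^sub>R fact n)" by (simp add: power_mult_distrib divide_inverse_commute)
    finally have "B * K ^ n / fact n * \<bar>t\<bar> ^ n \<le> B * ((K * N) ^ n /\<^sub>R fact n)" .
    with bound[of n] show ?thesis unfolding real_norm_def by (meson order_trans)
  qed
  have sM: "summable (\<lambda>n. B * ((K * N) ^ n /\<^sub>R fact n))" for N
    using summable_exp_generic[of "K * N"] by (intro summable_mult)
  have sf: "summable (\<lambda>n. f n t)" and sg: "summable (\<lambda>n. g n t)" for t
    by (rule summable_comparison_test'[OF sM[of "\<bar>t\<bar>"], of 0]; use unif[of t "\<bar>t\<bar>"] in simp)+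
  define u v where "u t = (\<Sum>n. f n t)" and "v t = (\<Sum>n. g n t)" for t
  \<comment> \<open>The termwise derivatives are the other series shifted by one index, with 0 for
    the constant first term.\<close>
  define f' g' where "f' n t = (case n of 0 \<Rightarrow> 0 | Suc k \<Rightarrow> g k t)"
    and "g' n t = (case n of 0 \<Rightarrow> 0 | Suc k \<Rightarrow> q t * f k t)" for n t
  have f': "(f n has_real_derivative f' n t) (at t)" and g': "(g n has_real_derivative g' n t) (at t)" for n t
    by (cases n; use df dg in \<open>auto simp: f'_def g'_def f0 g0\<close>)+
  have shift_sum: "(\<Sum>n. h n) = (\<Sum>n. h (Suc n))" if "summable (\<lambda>n. h (Suc n))" "h 0 = 0" for h :: "nat \<Rightarrow> real"
    using suminf_split_head[of h] that summable_Suc_iff[of h] by simp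
  have "(u has_real_derivative v t) (at t) \<and> (v has_real_derivative q t * u t) (at t)" for t
  proof
    \<comment> \<open>The added 1 puts t into the interior of \<open>?S\<close>; the extra factor
      \<open>K\<close> in \<open>?M\<close> absorbs q.\<close>
    let ?N = "\<bar>t\<bar> + 1"
    let ?M = "\<lambda>n. case n of 0 \<Rightarrow> 0 | Suc k \<Rightarrow> K * (B * ((K * ?N) ^ k /\<^sub>R fact k))"
    let ?S = "{- ?N..?N}"
    have sM': "summable ?M" using summable_mult[OF sM[of ?N]]
      by (subst summable_Suc_iff[symmetric]) simp
    have Mnn: "B * ((K * ?N) ^ k /\<^sub>R fact k) \<ge> 0" for k using K by auto
    have b1: "norm (f' n x) \<le> ?M n" if "x \<in> ?S" for n x
    proof (cases n)
      case (Suc k)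
      have "norm (g k x) \<le> 1 * (B * ((K * ?N) ^ k /\<^sub>R fact k))" using unif[of x ?N k] that by auto
      also have "\<dots> \<le> K * (B * ((K * ?N) ^ k /\<^sub>R fact k))" using Mnn K by (intro mult_right_mono) auto
      finally show ?thesis using Suc by (simp add: f'_def)
    qed (simp add: f'_def)
    have b2: "norm (g' n x) \<le> ?M n" if "x \<in> ?S" for n x
    proof (cases n)
      case (Suc k)
      have "norm (q x) * norm (f k x) \<le> K * (B * ((K * ?N) ^ k /\<^sub>R fact k))"
        using unif[of x ?N k] that bd[of x] K by (intro mult_mono) auto
      then show ?thesis using Suc by (simp add: g'_def abs_mult)
    qed (simp add: g'_def)
    have int: "t \<in> interior ?S" by (auto simp: interior_atLeastAtMost_real)
    have "((\<lambda>x. \<Sum>n. f n x) has_real_derivative (\<Sum>n. f' n t)) (at t)"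
      by (rule has_field_derivative_series'(2)[of ?S f f' 0])
        (use f' int sf b1 sM' in \<open>auto intro: has_field_derivative_at_within intro!: Weierstrass_m_test'\<close>)
    moreover have "(\<Sum>n. f' n t) = v t"
      using shift_sum[of "\<lambda>n. f' n t"] sg[of t] by (simp add: v_def f'_def)
    ultimately show "(u has_real_derivative v t) (at t)" by (simp add: u_def[abs_def])
    have "((\<lambda>x. \<Sum>n. g n x) has_real_derivative (\<Sum>n. g' n t)) (at t)"
      by (rule has_field_derivative_series'(2)[of ?S g g' 0])
        (use g' int sg b2 sM' in \<open>auto intro: has_field_derivative_at_within intro!: Weierstrass_m_test'\<close>)
    moreover have "(\<Sum>n. g' n t) = q t * u t"
      using shift_sum[of "\<lambda>n. g' n t"] sf[of t]
      by (simp add: u_def g'_def summable_mult suminf_mult)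
    ultimately show "(v has_real_derivative q t * u t) (at t)" by (simp add: v_def[abs_def])
  qed
  moreover have "u 0 = \<alpha>" "v 0 = \<beta>"
  proof -
    have "(\<lambda>n. f n 0) sums (\<Sum>n\<in>{0}. f n 0)" "(\<lambda>n. g n 0) sums (\<Sum>n\<in>{0}. g n 0)"
      by (intro sums_finite; use df(1) dg(1) in \<open>metis finite.simps insertI1 not0_implies_Suc\<close>
        | simp)+
    then show "u 0 = \<alpha>" "v 0 = \<beta>" by (auto simp: u_def v_def f0 g0 dest: sums_unique)
  qed
  ultimately show ?thesis unfolding ode_sol_def by blast
qed

section \<open>Gronwall's inequality, perturbation and uniqueness\<close>

lemma gronwall:
  fixes E E' :: "real \<Rightarrow> real"
  assumes dE: "\<And>t. t \<ge> 0 \<Longrightarrow> (E has_real_derivative E' t) (at t)"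
    and le: "\<And>t. 0 \<le> t \<Longrightarrow> t \<le> T \<Longrightarrow> E' t \<le> C * E t + H" and C: "C \<ge> 0" and H: "H \<ge> 0" and T: "T \<ge> 0"
  shows "E T \<le> (E 0 + H * T) * exp (C * T)"
proof -
  \<comment> \<open>\<open>exp (- C * t)\<close> is the integrating factor. It is at most 1 on
    [0, T], so subtracting \<open>H * t\<close> compensates the inhomogeneous term.\<close>
  define G where "G t = E t * exp (- C * t) - H * t" for t
  have "G T \<le> G 0"
  proof (rule DERIV_nonpos_imp_nonincreasing[OF T])
    fix x assume x: "0 \<le> x" "x \<le> T"
    have "(G has_real_derivative (E' x - C * E x) * exp (- C * x) - H) (at x)"
      unfolding G_def[abs_def] by (auto intro!: derivative_eq_intros dE x simp: algebra_simps)
    moreover have "(E' x - C * E x) * exp (- C * x) \<le> H * exp (- C * x)"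
      using le[OF x] by (intro mult_right_mono) auto
    moreover have "H * exp (- C * x) \<le> H * 1" using H C x by (intro mult_left_mono) auto
    ultimately show "\<exists>y. (G has_real_derivative y) (at x) \<and> y \<le> 0"
      by (intro exI[of _ "(E' x - C * E x) * exp (- C * x) - H"] conjI) linarith+
  qed
  then have "E T * exp (- C * T) \<le> E 0 + H * T" by (simp add: G_def)
  then have "E T * exp (- C * T) * exp (C * T) \<le> (E 0 + H * T) * exp (C * T)"
    by (intro mult_right_mono) auto
  then show ?thesis by (simp add: mult.assoc flip: exp_add)
qed

text \<open>Translation and time reversal preserve the form of the equation because k^2 = 1. This
  allows estimates based at 0 to be used from any \<open>t0\<close> in either direction, and also
  translation by a period.\<close>

lemma ode_sol_affine:
  assumes "ode_sol q u v" and "k = 1 \<or> k = -1"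
  shows "ode_sol (\<lambda>t. q (t0 + k * t)) (\<lambda>t. u (t0 + k * t)) (\<lambda>t. k * v (t0 + k * t))"
proof -
  have u: "(u has_real_derivative v t) (at t)" and v: "(v has_real_derivative q t * u t) (at t)" for t
    using assms by (auto simp: ode_sol_def)
  have l: "((\<lambda>t. t0 + k * t) has_real_derivative k) (at t)" for t
    by (auto intro!: derivative_eq_intros)
  show ?thesis unfolding ode_sol_def
  proof (intro allI conjI)
    fix t
    show "((\<lambda>t. u (t0 + k * t)) has_real_derivative k * v (t0 + k * t)) (at t)"
      by (rule DERIV_cong[OF DERIV_chain2[OF u l]]) (rule mult.commute)
    show "((\<lambda>t. k * v (t0 + k * t)) has_real_derivative q (t0 + k * t) * u (t0 + k * t)) (at t)"
      using DERIV_cmult[OF DERIV_chain2[OF v l], of k] assms(2) by (auto simp: mult.commute)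
  qed
qed

lemma ode_sol_linear:
  assumes "ode_sol q u v" and "ode_sol q w z"
  shows "ode_sol q (\<lambda>t. \<alpha> * u t + \<beta> * w t) (\<lambda>t. \<alpha> * v t + \<beta> * z t)"
  using assms unfolding ode_sol_def
  by (auto intro!: derivative_eq_intros simp: algebra_simps)

text \<open>Gronwall for the squared distance in the phase plane. The inequality 2xy <= x^2 + y^2 on
  the cross terms yields the rate \<open>2 + Q\<close> and the forcing \<open>h\<^sup>2\<close>. The
  estimate serves both uniqueness (h = 0) and continuous dependence on the parameter.\<close>

lemma ode_sol_perturb:
  assumes 1: "ode_sol q1 u1 v1" and 2: "ode_sol q2 u2 v2"
    and init: "u1 0 = u2 0" "v1 0 = v2 0" and T: "T \<ge> 0"
    and Q: "\<And>t. 0 \<le> t \<Longrightarrow> t \<le> T \<Longrightarrow> \<bar>q1 t\<bar> \<le> Q"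
    and H: "\<And>t. 0 \<le> t \<Longrightarrow> t \<le> T \<Longrightarrow> \<bar>(q1 t - q2 t) * u2 t\<bar> \<le> h"
  shows "(u1 T - u2 T)\<^sup>2 + (v1 T - v2 T)\<^sup>2 \<le> h\<^sup>2 * T * exp ((2 + Q) * T)"
proof -
  define d e where "d t = u1 t - u2 t" and "e t = v1 t - v2 t" for t
  define E where "E t = (d t)\<^sup>2 + (e t)\<^sup>2" for t
  let ?E' = "\<lambda>t. 2 * d t * e t + 2 * e t * (q1 t * d t + (q1 t - q2 t) * u2 t)"
  have dd: "(d has_real_derivative e t) (at t)" for t
    unfolding d_def[abs_def] e_def using 1 2 by (auto simp: ode_sol_def intro: DERIV_diff)
  have de: "(e has_real_derivative q1 t * d t + (q1 t - q2 t) * u2 t) (at t)" for t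
  proof -
    have "(e has_real_derivative q1 t * u1 t - q2 t * u2 t) (at t)"
      unfolding e_def[abs_def] using 1 2 by (auto simp: ode_sol_def intro: DERIV_diff)
    then show ?thesis by (simp add: d_def algebra_simps)
  qed
  have "E T \<le> (E 0 + h\<^sup>2 * T) * exp ((2 + Q) * T)"
  proof (rule gronwall[where E' = ?E'])
    show "(E has_real_derivative ?E' t) (at t)" for t
      unfolding E_def[abs_def] by (auto intro!: derivative_eq_intros dd de)
    fix t assume t: "0 \<le> t" "t \<le> T"
    let ?r = "(q1 t - q2 t) * u2 t"
    have a1: "2 * x * y \<le> x\<^sup>2 + y\<^sup>2" for x y :: real using sum_squares_bound[of x y] by simp
    have h2: "?r\<^sup>2 \<le> h\<^sup>2" using H[OF t] by (metis abs_le_square_iff abs_ge_self order_trans)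
    have q2: "2 * e t * (q1 t * d t) \<le> Q * ((d t)\<^sup>2 + (e t)\<^sup>2)"
    proof -
      have "2 * e t * (q1 t * d t) \<le> \<bar>q1 t\<bar> * (2 * \<bar>d t\<bar> * \<bar>e t\<bar>)"
        using abs_ge_self[of "2 * e t * (q1 t * d t)"] by (simp add: abs_mult algebra_simps)
      also have "\<dots> \<le> Q * ((d t)\<^sup>2 + (e t)\<^sup>2)"
        using Q[OF t] a1[of "\<bar>d t\<bar>" "\<bar>e t\<bar>"] by (intro mult_mono) auto
      finally show ?thesis .
    qed
    show "?E' t \<le> (2 + Q) * E t + h\<^sup>2"
      using a1[of "d t" "e t"] a1[of "e t" ?r] q2 h2
      by (simp add: E_def algebra_simps) (smt (verit) zero_le_power2)
  qed (use T Q[of 0] in auto)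
  then show ?thesis using init by (simp add: E_def d_def e_def)
qed

lemma ode_sol_zero: "ode_sol q (\<lambda>_. 0) (\<lambda>_. 0)"
  by (simp add: ode_sol_def)

text \<open>Comparison with the zero solution, run forwards and backwards from
  \<open>t0\<close>.\<close>

lemma ode_sol_unique_zero:
  assumes s: "ode_sol q u v" and bd: "\<And>t. \<bar>q t\<bar> \<le> Q" and z: "u t0 = 0" "v t0 = 0"
  shows "u t = 0 \<and> v t = 0"
proof -
  have *: "u (t0 + k * T) = 0 \<and> v (t0 + k * T) = 0" if "T \<ge> 0" "k = 1 \<or> k = -1" for k T
  proof -
    have "(u (t0 + k * T) - 0)\<^sup>2 + (k * v (t0 + k * T) - 0)\<^sup>2 \<le> 0\<^sup>2 * T * exp ((2 + Q) * T)"
      by (rule ode_sol_perturb[OF ode_sol_affine[OF s that(2), of t0] ode_sol_zero])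
        (use z bd that in auto)
    then show ?thesis using that(2) by (auto simp: sum_power2_le_zero_iff)
  qed
  show ?thesis using *[of "t - t0" 1] *[of "t0 - t" "-1"] by (cases "t \<ge> t0") auto
qed

lemma ode_sol_wronskian:
  assumes "ode_sol q u v" and "ode_sol q w z"
  shows "u t * z t - v t * w t = u 0 * z 0 - v 0 * w 0"
proof -
  have "((\<lambda>t. u t * z t - v t * w t) has_real_derivative 0) (at t)" for t
    using assms unfolding ode_sol_def by (auto intro!: derivative_eq_intros)
  then show ?thesis using DERIV_isconst_all by blast
qed

section \<open>Hill's equation\<close>

text \<open>The comparison function sin(k (t - x)) with k = pi / (y - x) vanishes at x and y. Its
  Wronskian \<open>W\<close> with a positive u would be nondecreasing, yet it equals k u(x) > 0 at x
  and - k u(y) < 0 at y.\<close>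

lemma sturm_positive_solution:
  assumes s: "ode_sol q u v" and xy: "x < y"
    and q: "\<And>t. x \<le> t \<Longrightarrow> t \<le> y \<Longrightarrow> q t \<le> - (pi / (y - x))\<^sup>2"
    and pos: "\<And>t. x \<le> t \<Longrightarrow> t \<le> y \<Longrightarrow> u t > 0"
  shows False
proof -
  define k where "k = pi / (y - x)"
  have k: "k > 0" "k * (y - x) = pi" using xy by (auto simp: k_def)
  define W where "W t = u t * (k * cos (k * (t - x))) - v t * sin (k * (t - x))" for t
  have "W x \<le> W y"
  proof (rule DERIV_nonneg_imp_nondecreasing[OF less_imp_le[OF xy]])
    fix t assume t: "x \<le> t" "t \<le> y"
    have du: "(u has_real_derivative v t) (at t)" "(v has_real_derivative q t * u t) (at t)"
      using s by (auto simp: ode_sol_def)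
    have "(W has_real_derivative (- k\<^sup>2 - q t) * u t * sin (k * (t - x))) (at t)"
      unfolding W_def[abs_def]
      by (auto intro!: derivative_eq_intros du simp: algebra_simps power2_eq_square)
    moreover have "sin (k * (t - x)) \<ge> 0"
    proof (rule sin_ge_zero)
      have "k * (t - x) \<le> k * (y - x)" using t k by (intro mult_left_mono) auto
      then show "k * (t - x) \<le> pi" using k by simp
    qed (use t k in auto)
    moreover have "- k\<^sup>2 - q t \<ge> 0" using q[OF t] by (simp add: k_def)
    ultimately show "\<exists>z. (W has_real_derivative z) (at t) \<and> 0 \<le> z"
      using pos[OF t] by (intro exI[of _ "(- k\<^sup>2 - q t) * u t * sin (k * (t - x))"] conjI mult_nonneg_nonneg) auto
  qed
  moreover have "W x = u x * k" "W y = - (u y * k)" by (simp_all add: W_def k)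
  ultimately show False using pos[of x] pos[of y] k xy by (smt (verit) mult_pos_pos)
qed

section \<open>Functions of period 1 on the line\<close>

lemma periodic_add_of_int:
  fixes f :: "real \<Rightarrow> 'a"
  assumes "\<And>t. f (t + 1) = f t"
  shows "f (t + of_int k) = f t"
proof (induction k arbitrary: t rule: int_induct[where k = 0])
  case (step1 i)
  then show ?case using assms[of "t + of_int i"] by (simp add: algebra_simps)
next
  case (step2 i)
  then show ?case using assms[of "t + of_int (i - 1)"] by (simp add: algebra_simps)
qed simp

lemma periodic_frac:
  fixes f :: "real \<Rightarrow> 'a"
  assumes "\<And>t. f (t + 1) = f t"
  shows "f (frac t) = f t"
  using periodic_add_of_int[of f "frac t" "\<lfloor>t\<rfloor>", OF assms] by (simp add: frac_def)

lemma periodic_bounded: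
  fixes f :: "real \<Rightarrow> real"
  assumes "continuous_on UNIV f" and "\<And>t. f (t + 1) = f t"
  obtains B where "\<And>t. \<bar>f t\<bar> \<le> B"
proof -
  have "continuous_on {0..1} f" using assms(1) continuous_on_subset by blast
  then have "bounded (f ` {0..1})" by (intro compact_imp_bounded compact_continuous_image) auto
  then obtain B where B: "\<And>t. t \<in> {0..1} \<Longrightarrow> \<bar>f t\<bar> \<le> B"
    unfolding bounded_iff by (metis image_eqI real_norm_def)
  have "\<bar>f t\<bar> \<le> B" for t
    using B[of "frac t"] periodic_frac[of f t, OF assms(2)] frac_lt_1[of t] by simp
  then show ?thesis using that by blast
qed

text \<open>Monotonicity squeezes f(x) between its values at the floor and the ceiling of x, both
  equal to f(0). The lemma replaces integrating an energy identity over a period.\<close>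

lemma monotone_periodic_deriv_zero:
  fixes f :: "real \<Rightarrow> real"
  assumes d: "\<And>t. (f has_real_derivative f' t) (at t)" and nn: "\<And>t. f' t \<ge> 0"
    and per: "\<And>t. f (t + 1) = f t"
  shows "f' t = 0"
proof -
  have mono: "f x \<le> f y" if "x \<le> y" for x y
    by (rule DERIV_nonneg_imp_nondecreasing[OF that]) (use d nn in blast)
  have "f x = f 0" for x
  proof -
    have "f x \<le> f (0 + of_int \<lceil>x\<rceil>)" "f (0 + of_int \<lfloor>x\<rfloor>) \<le> f x" by (auto intro!: mono)
    then show ?thesis using periodic_add_of_int[of f 0, OF per] by simp
  qed
  then have "f = (\<lambda>_. f 0)" by auto
  then have "(f has_real_derivative 0) (at t)" by (metis DERIV_const)
  with d[of t] show ?thesis using DERIV_unique by blast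
qed

lemma singular_2x2:
  fixes A B C E :: real
  assumes "A * E - B * C = 0"
  obtains x y where "A * x + B * y = 0" "C * x + E * y = 0" "x \<noteq> 0 \<or> y \<noteq> 0"
proof -
  consider "A \<noteq> 0 \<or> B \<noteq> 0" | "C \<noteq> 0 \<or> E \<noteq> 0" | "A = 0" "B = 0" "C = 0" "E = 0" by blast
  then show ?thesis
  proof cases
    case 1
    then show ?thesis using assms by (intro that[of "- B" A]) (auto simp: algebra_simps)
  next
    case 2
    then show ?thesis using assms by (intro that[of "- E" C]) (auto simp: algebra_simps)
  qed (use that[of 1 0] in auto)
qed

section \<open>Fundamental solutions and their dependence on the parameter\<close>

locale hill_equation =
  fixes r s :: "real \<Rightarrow> real"
  assumes cont: "continuous_on UNIV r" "continuous_on UNIV s"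
    and per: "\<And>t. r (t + 1) = r t" "\<And>t. s (t + 1) = s t"
    and r_pos: "\<And>t. r t > 0"
begin

definition q :: "real \<Rightarrow> real \<Rightarrow> real" where "q \<kappa> t = \<kappa> * r t - s t"

text \<open>The two bounds, uniform in t, are the inputs that \<open>ode_sol_perturb\<close> asks
  for when two parameters are compared.\<close>

lemma q_bounded: obtains Q where "Q \<ge> 0" "\<And>\<kappa> t. \<bar>q \<kappa> t\<bar> \<le> (\<bar>\<kappa>\<bar> + 1) * Q"
  "\<And>\<kappa> \<mu> t. \<bar>q \<kappa> t - q \<mu> t\<bar> \<le> \<bar>\<kappa> - \<mu>\<bar> * Q"
proof -
  obtain R S where R: "\<And>t. \<bar>r t\<bar> \<le> R" and S: "\<And>t. \<bar>s t\<bar> \<le> S"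
    using periodic_bounded[OF cont(1) per(1)] periodic_bounded[OF cont(2) per(2)] by metis
  let ?Q = "max R S"
  have "\<bar>q \<kappa> t\<bar> \<le> (\<bar>\<kappa>\<bar> + 1) * ?Q" for \<kappa> t
  proof -
    have "\<bar>q \<kappa> t\<bar> \<le> \<bar>\<kappa>\<bar> * \<bar>r t\<bar> + \<bar>s t\<bar>"
      unfolding q_def by (metis abs_mult abs_triangle_ineq4)
    also have "\<dots> \<le> \<bar>\<kappa>\<bar> * ?Q + ?Q"
      using R[of t] S[of t] by (intro add_mono mult_left_mono) auto
    finally show ?thesis by (simp add: algebra_simps)
  qed
  moreover have "\<bar>q \<kappa> t - q \<mu> t\<bar> \<le> \<bar>\<kappa> - \<mu>\<bar> * ?Q" for \<kappa> \<mu> t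
  proof -
    have "\<bar>q \<kappa> t - q \<mu> t\<bar> = \<bar>\<kappa> - \<mu>\<bar> * \<bar>r t\<bar>"
      by (simp add: q_def algebra_simps flip: abs_mult)
    also have "\<dots> \<le> \<bar>\<kappa> - \<mu>\<bar> * ?Q" using R[of t] by (intro mult_left_mono) auto
    finally show ?thesis .
  qed
  moreover have "?Q \<ge> 0" using R[of 0] by linarith
  ultimately show ?thesis using that by blast
qed

lemma ode_sol_q_unique_zero:
  assumes "ode_sol (q \<kappa>) u v" and "u t0 = 0" "v t0 = 0"
  shows "u t = 0 \<and> v t = 0"
  by (rule q_bounded, rule ode_sol_unique_zero[OF assms(1) _ assms(2,3)])

text \<open>The choice is meaningful by \<open>ode_sol_exists\<close> and immaterial by uniqueness.
  The data (1, 0) and (0, 1) give the columns of the fundamental matrix.\<close>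

definition fund :: "real \<Rightarrow> real \<Rightarrow> real \<Rightarrow> (real \<Rightarrow> real) \<times> (real \<Rightarrow> real)" where
  "fund \<alpha> \<beta> \<kappa> = (SOME p. ode_sol (q \<kappa>) (fst p) (snd p) \<and> fst p 0 = \<alpha> \<and> snd p 0 = \<beta>)"

abbreviation "\<phi> \<kappa> \<equiv> fst (fund 1 0 \<kappa>)"
abbreviation "\<phi>' \<kappa> \<equiv> snd (fund 1 0 \<kappa>)"
abbreviation "\<psi> \<kappa> \<equiv> fst (fund 0 1 \<kappa>)"
abbreviation "\<psi>' \<kappa> \<equiv> snd (fund 0 1 \<kappa>)"

lemma fund: "ode_sol (q \<kappa>) (fst (fund \<alpha> \<beta> \<kappa>)) (snd (fund \<alpha> \<beta> \<kappa>))"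
  "fst (fund \<alpha> \<beta> \<kappa>) 0 = \<alpha>" "snd (fund \<alpha> \<beta> \<kappa>) 0 = \<beta>"
proof -
  obtain Q where Q: "\<And>\<kappa> t. \<bar>q \<kappa> t\<bar> \<le> (\<bar>\<kappa>\<bar> + 1) * Q" by (rule q_bounded) blast
  have "continuous_on UNIV (q \<kappa>)"
    unfolding q_def[abs_def] using cont by (intro continuous_intros) auto
  from ode_sol_exists[OF this Q, of \<alpha> \<beta>]
  have "\<exists>p. ode_sol (q \<kappa>) (fst p) (snd p) \<and> fst p 0 = \<alpha> \<and> snd p 0 = \<beta>" by auto
  from someI_ex[OF this]
  show "ode_sol (q \<kappa>) (fst (fund \<alpha> \<beta> \<kappa>)) (snd (fund \<alpha> \<beta> \<kappa>))"
    "fst (fund \<alpha> \<beta> \<kappa>) 0 = \<alpha>" "snd (fund \<alpha> \<beta> \<kappa>) 0 = \<beta>"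
    by (auto simp: fund_def)
qed

lemma fund_deriv:
  "(fst (fund \<alpha> \<beta> \<kappa>) has_real_derivative snd (fund \<alpha> \<beta> \<kappa>) t) (at t)"
  "(snd (fund \<alpha> \<beta> \<kappa>) has_real_derivative q \<kappa> t * fst (fund \<alpha> \<beta> \<kappa>) t) (at t)"
  using fund(1)[of \<kappa> \<alpha> \<beta>] by (auto simp: ode_sol_def)

lemma fund_continuous: "continuous_on A (fst (fund \<alpha> \<beta> \<kappa>))" "continuous_on A (snd (fund \<alpha> \<beta> \<kappa>))"
  using fund_deriv by (meson DERIV_isCont continuous_at_imp_continuous_on)+

lemma ode_sol_fund:
  assumes s: "ode_sol (q \<kappa>) u v"
  shows "u t = u 0 * \<phi> \<kappa> t + v 0 * \<psi> \<kappa> t" "v t = u 0 * \<phi>' \<kappa> t + v 0 * \<psi>' \<kappa> t"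
proof -
  have "ode_sol (q \<kappa>) (\<lambda>t. 1 * u t + -1 * (u 0 * \<phi> \<kappa> t + v 0 * \<psi> \<kappa> t))
      (\<lambda>t. 1 * v t + -1 * (u 0 * \<phi>' \<kappa> t + v 0 * \<psi>' \<kappa> t))"
    by (intro ode_sol_linear s fund)
  from ode_sol_q_unique_zero[OF this, of 0 t]
  show "u t = u 0 * \<phi> \<kappa> t + v 0 * \<psi> \<kappa> t" "v t = u 0 * \<phi>' \<kappa> t + v 0 * \<psi>' \<kappa> t"
    by (auto simp: fund)
qed

text \<open>Solutions are Lipschitz in the parameter near \<mu>, uniformly on [0, 1]:
  \<open>ode_sol_perturb\<close> applies with h = |\<kappa> - \<mu>| Q U, where \<open>U\<close>
  bounds the solution at \<mu>.\<close>

lemma fund_close: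
  assumes "e > 0"
  obtains d where "d > 0" "\<And>\<kappa> t. \<bar>\<kappa> - \<mu>\<bar> < d \<Longrightarrow> 0 \<le> t \<Longrightarrow> t \<le> 1 \<Longrightarrow>
    \<bar>fst (fund \<alpha> \<beta> \<kappa>) t - fst (fund \<alpha> \<beta> \<mu>) t\<bar> < e \<and> \<bar>snd (fund \<alpha> \<beta> \<kappa>) t - snd (fund \<alpha> \<beta> \<mu>) t\<bar> < e"
proof -
  let ?u = "\<lambda>\<kappa>. fst (fund \<alpha> \<beta> \<kappa>)" and ?v = "\<lambda>\<kappa>. snd (fund \<alpha> \<beta> \<kappa>)"
  obtain Q where Q: "Q \<ge> 0" "\<And>\<kappa> t. \<bar>q \<kappa> t\<bar> \<le> (\<bar>\<kappa>\<bar> + 1) * Q"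
    "\<And>\<kappa> \<mu> t. \<bar>q \<kappa> t - q \<mu> t\<bar> \<le> \<bar>\<kappa> - \<mu>\<bar> * Q" by (rule q_bounded) blast
  have "bounded (?u \<mu> ` {0..1})"
    by (intro compact_imp_bounded compact_continuous_image fund_continuous) auto
  then obtain U where U: "U > 0" "\<And>t. t \<in> {0..1} \<Longrightarrow> \<bar>?u \<mu> t\<bar> \<le> U" by (auto simp: bounded_pos)
  \<comment> \<open>\<open>Q1\<close> bounds \<open>q \<kappa>\<close> for all \<kappa> with
    |\<kappa> - \<mu>| < 1. The exponent is halved in \<open>K\<close> because Gronwall bounds the
    squared distance; the summand 1 makes \<open>K\<close> positive.\<close>
  define Q1 where "Q1 = (\<bar>\<mu>\<bar> + 2) * Q"
  define K where "K = Q * U * exp ((2 + Q1) / 2) + 1"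
  have Q1: "Q1 \<ge> 0" using Q by (simp add: Q1_def)
  have K: "K > 0" unfolding K_def using Q U by (smt (verit) exp_gt_zero mult_nonneg_nonneg)
  have main: "\<bar>?u \<kappa> t - ?u \<mu> t\<bar> \<le> \<bar>\<kappa> - \<mu>\<bar> * K \<and> \<bar>?v \<kappa> t - ?v \<mu> t\<bar> \<le> \<bar>\<kappa> - \<mu>\<bar> * K"
    if l: "\<bar>\<kappa> - \<mu>\<bar> < 1" and t: "0 \<le> t" "t \<le> 1" for \<kappa> t
  proof -
    let ?h = "\<bar>\<kappa> - \<mu>\<bar> * (Q * U)"
    have "(?u \<kappa> t - ?u \<mu> t)\<^sup>2 + (?v \<kappa> t - ?v \<mu> t)\<^sup>2 \<le> ?h\<^sup>2 * t * exp ((2 + Q1) * t)"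
    proof (rule ode_sol_perturb[OF fund(1) fund(1)])
      fix x assume x: "0 \<le> x" "x \<le> t"
      have "(\<bar>\<kappa>\<bar> + 1) * Q \<le> Q1" unfolding Q1_def using Q l by (intro mult_right_mono) auto
      then show "\<bar>q \<kappa> x\<bar> \<le> Q1" using Q(2)[of \<kappa> x] by linarith
      have "\<bar>q \<kappa> x - q \<mu> x\<bar> * \<bar>?u \<mu> x\<bar> \<le> (\<bar>\<kappa> - \<mu>\<bar> * Q) * U"
        using Q U x t by (intro mult_mono) auto
      then show "\<bar>(q \<kappa> x - q \<mu> x) * ?u \<mu> x\<bar> \<le> ?h" by (simp add: abs_mult mult.assoc)
    qed (use t in \<open>auto simp: fund\<close>)
    also have "\<dots> \<le> ?h\<^sup>2 * 1 * exp ((2 + Q1) * 1)"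
      using t Q1 by (intro mult_mono) auto
    also have "\<dots> = (?h * exp ((2 + Q1) / 2))\<^sup>2"
      by (simp add: power_mult_distrib flip: exp_double)
    also have "\<dots> \<le> (\<bar>\<kappa> - \<mu>\<bar> * K)\<^sup>2"
    proof (rule power_mono)
      have "Q * U * exp ((2 + Q1) / 2) \<le> K" by (simp add: K_def)
      from mult_left_mono[OF this, of "\<bar>\<kappa> - \<mu>\<bar>"]
      show "?h * exp ((2 + Q1) / 2) \<le> \<bar>\<kappa> - \<mu>\<bar> * K" by (simp add: mult.assoc)
    qed (use Q U in simp)
    finally have *: "(?u \<kappa> t - ?u \<mu> t)\<^sup>2 + (?v \<kappa> t - ?v \<mu> t)\<^sup>2 \<le> (\<bar>\<kappa> - \<mu>\<bar> * K)\<^sup>2" .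
    have "x\<^sup>2 + y\<^sup>2 \<le> z\<^sup>2 \<Longrightarrow> z \<ge> 0 \<Longrightarrow> \<bar>x\<bar> \<le> z \<and> \<bar>y\<bar> \<le> z" for x y z :: real
      using power2_le_iff_abs_le[of z x] power2_le_iff_abs_le[of z y]
        zero_le_power2[of x] zero_le_power2[of y] by linarith
    moreover have "\<bar>\<kappa> - \<mu>\<bar> * K \<ge> 0" using K by simp
    ultimately show ?thesis using * by blast
  qed
  have "\<bar>\<kappa> - \<mu>\<bar> * K < e" if "\<bar>\<kappa> - \<mu>\<bar> < e / K" for \<kappa>
    using that K by (simp add: pos_less_divide_eq)
  then have "\<bar>?u \<kappa> t - ?u \<mu> t\<bar> < e \<and> \<bar>?v \<kappa> t - ?v \<mu> t\<bar> < e"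
    if "\<bar>\<kappa> - \<mu>\<bar> < min 1 (e / K)" "0 \<le> t" "t \<le> 1" for \<kappa> t
    using main[of \<kappa> t] that by (meson le_less_trans min_less_iff_conj)
  moreover have "min 1 (e / K) > 0" using K assms by simp
  ultimately show ?thesis using that by blast
qed

section \<open>The discriminant and periodic solutions\<close>

definition D :: "real \<Rightarrow> real" where "D \<kappa> = \<phi> \<kappa> 1 + \<psi>' \<kappa> 1"

lemma D_continuous: "continuous_on UNIV D"
proof (rule continuous_at_imp_continuous_on, intro ballI, subst continuous_at_eps_delta, intro allI impI)
  fix \<mu> e :: real assume "e > 0"
  then have e2: "e / 2 > 0" by simp
  obtain d1 where d1: "d1 > 0" "\<And>\<kappa>. \<bar>\<kappa> - \<mu>\<bar> < d1 \<Longrightarrow> \<bar>\<phi> \<kappa> 1 - \<phi> \<mu> 1\<bar> < e / 2"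
    using fund_close[OF e2, of \<mu> 1 0] by (metis order_refl zero_le_one)
  obtain d2 where d2: "d2 > 0" "\<And>\<kappa>. \<bar>\<kappa> - \<mu>\<bar> < d2 \<Longrightarrow> \<bar>\<psi>' \<kappa> 1 - \<psi>' \<mu> 1\<bar> < e / 2"
    using fund_close[OF e2, of \<mu> 0 1] by (metis order_refl zero_le_one)
  have "\<bar>D \<kappa> - D \<mu>\<bar> < e" if "\<bar>\<kappa> - \<mu>\<bar> < min d1 d2" for \<kappa>
    using d1(2)[of \<kappa>] d2(2)[of \<kappa>] that unfolding D_def by linarith
  then show "\<exists>d>0. \<forall>x'. dist x' \<mu> < d \<longrightarrow> dist (D x') (D \<mu>) < e"
    using d1(1) d2(1) by (intro exI[of _ "min d1 d2"]) (auto simp: dist_real_def)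
qed

lemma wronskian: "\<phi> \<kappa> t * \<psi>' \<kappa> t - \<phi>' \<kappa> t * \<psi> \<kappa> t = 1"
  using ode_sol_wronskian[OF fund(1)[of \<kappa> 1 0] fund(1)[of \<kappa> 0 1], of t] by (simp add: fund)

text \<open>The nonzero vector (u 0, v 0) is fixed by the monodromy matrix M. Since det M = 1 by
  \<open>wronskian\<close>, det(M - I) = 2 - \<open>D \<kappa>\<close>, which must vanish.\<close>

lemma periodic_solution_D:
  assumes s: "ode_sol (q \<kappa>) u v" and p: "\<And>t. u (t + 1) = u t" and nz: "u x \<noteq> 0"
  shows "D \<kappa> = 2"
proof -
  have "v 1 = v 0"
  proof -
    have "((\<lambda>t. u (t + 1)) has_real_derivative v (0 + 1)) (at 0)"
      using s unfolding ode_sol_def by (metis DERIV_shift)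
    then have "(u has_real_derivative v 1) (at 0)" by (simp add: p)
    then show ?thesis using s DERIV_unique unfolding ode_sol_def by blast
  qed
  then have eqs: "u 0 * \<phi> \<kappa> 1 + v 0 * \<psi> \<kappa> 1 = u 0" "u 0 * \<phi>' \<kappa> 1 + v 0 * \<psi>' \<kappa> 1 = v 0"
    using ode_sol_fund[OF s, of 1] p[of 0] by auto
  have nz0: "u 0 \<noteq> 0 \<or> v 0 \<noteq> 0" using ode_sol_q_unique_zero[OF s, of 0 x] nz by blast
  \<comment> \<open>These two identities multiply (M - I)(u 0, v 0) by the adjugate of M - I; the
    last summand corrects for det M = 1.\<close>
  have "(2 - D \<kappa>) * u 0 = (\<psi>' \<kappa> 1 - 1) * (u 0 * \<phi> \<kappa> 1 + v 0 * \<psi> \<kappa> 1 - u 0)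
      - \<psi> \<kappa> 1 * (u 0 * \<phi>' \<kappa> 1 + v 0 * \<psi>' \<kappa> 1 - v 0)
      + (1 - (\<phi> \<kappa> 1 * \<psi>' \<kappa> 1 - \<phi>' \<kappa> 1 * \<psi> \<kappa> 1)) * u 0"
    unfolding D_def by (simp add: algebra_simps)
  moreover have "(2 - D \<kappa>) * v 0 = (\<phi> \<kappa> 1 - 1) * (u 0 * \<phi>' \<kappa> 1 + v 0 * \<psi>' \<kappa> 1 - v 0)
      - \<phi>' \<kappa> 1 * (u 0 * \<phi> \<kappa> 1 + v 0 * \<psi> \<kappa> 1 - u 0)
      + (1 - (\<phi> \<kappa> 1 * \<psi>' \<kappa> 1 - \<phi>' \<kappa> 1 * \<psi> \<kappa> 1)) * v 0"
    unfolding D_def by (simp add: algebra_simps)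
  ultimately have "(2 - D \<kappa>) * u 0 = 0 \<and> (2 - D \<kappa>) * v 0 = 0"
    unfolding eqs wronskian by simp
  then show ?thesis using nz0 by auto
qed

text \<open>Now det(M - I) = 0 supplies a nonzero fixed vector of M. The solution with these Cauchy
  data and its translate by one period agree at 0, hence everywhere.\<close>

lemma D_periodic_solution:
  assumes "D \<kappa> = 2"
  obtains u v x where "ode_sol (q \<kappa>) u v" "\<And>t. u (t + 1) = u t" "\<And>t. v (t + 1) = v t" "u x \<noteq> 0"
proof -
  have "(\<phi> \<kappa> 1 - 1) * (\<psi>' \<kappa> 1 - 1) - \<psi> \<kappa> 1 * \<phi>' \<kappa> 1 = 0"
    using assms wronskian[of \<kappa> 1] unfolding D_def by (simp add: algebra_simps)
  then obtain \<alpha> \<beta> where ab: "(\<phi> \<kappa> 1 - 1) * \<alpha> + \<psi> \<kappa> 1 * \<beta> = 0"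
    "\<phi>' \<kappa> 1 * \<alpha> + (\<psi>' \<kappa> 1 - 1) * \<beta> = 0" "\<alpha> \<noteq> 0 \<or> \<beta> \<noteq> 0" by (rule singular_2x2)
  let ?u = "fst (fund \<alpha> \<beta> \<kappa>)" and ?v = "snd (fund \<alpha> \<beta> \<kappa>)"
  have s: "ode_sol (q \<kappa>) ?u ?v" by (rule fund)
  have "ode_sol (\<lambda>t. q \<kappa> (1 + 1 * t)) (\<lambda>t. ?u (1 + 1 * t)) (\<lambda>t. 1 * ?v (1 + 1 * t))"
    by (rule ode_sol_affine[OF s]) simp
  moreover have "(\<lambda>t. q \<kappa> (1 + 1 * t)) = q \<kappa>"
    using per by (auto simp: q_def add.commute[of 1])
  ultimately have s1: "ode_sol (q \<kappa>) (\<lambda>t. ?u (1 + t)) (\<lambda>t. ?v (1 + t))" by simp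
  have "?u 1 = \<alpha>" "?v 1 = \<beta>"
    using ab ode_sol_fund[OF s, of 1] by (auto simp: fund algebra_simps)
  then have p: "?u (1 + t) = ?u t \<and> ?v (1 + t) = ?v t" for t
    using ode_sol_q_unique_zero[OF ode_sol_linear[OF s1 s, of 1 "-1"], of 0 t]
    by (simp add: fund)
  have "\<exists>x. ?u x \<noteq> 0"
  proof (rule ccontr)
    assume "\<nexists>x. ?u x \<noteq> 0"
    then have "?u = (\<lambda>_. 0)" by auto
    then have "?v 0 = 0" using fund_deriv(1)[of \<alpha> \<beta> \<kappa> 0] by (metis DERIV_const DERIV_unique)
    then show False using \<open>\<nexists>x. ?u x \<noteq> 0\<close> ab(3) fund(2,3) by metis
  qed
  then show ?thesis using that[OF s] p by (auto simp: add.commute)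
qed

section \<open>Location of the greatest parameter with discriminant 2\<close>

lemma D_eq_2_bound:
  assumes m: "\<And>t. s t \<le> m * r t" and D: "D \<kappa> = 2"
  shows "\<kappa> \<le> m"
proof (rule ccontr)
  assume l: "\<not> \<kappa> \<le> m"
  obtain u v x where s: "ode_sol (q \<kappa>) u v" and p: "\<And>t. u (t + 1) = u t" "\<And>t. v (t + 1) = v t"
    and x: "u x \<noteq> 0" using D_periodic_solution[OF D] by blast
  have qpos: "q \<kappa> t > 0" for t
  proof -
    have "m * r t < \<kappa> * r t" using l r_pos by (intro mult_strict_right_mono) auto
    then show ?thesis using m[of t] by (simp add: q_def)
  qed
  \<comment> \<open>Energy argument: u u' is periodic with nonnegative derivative u'^2 + q u^2, so
    this derivative vanishes, although q > 0 and u(x) is nonzero.\<close>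
  have "(v x)\<^sup>2 + q \<kappa> x * (u x)\<^sup>2 = 0"
  proof (rule monotone_periodic_deriv_zero[of "\<lambda>t. u t * v t" "\<lambda>t. (v t)\<^sup>2 + q \<kappa> t * (u t)\<^sup>2"])
    show "((\<lambda>t. u t * v t) has_real_derivative (v t)\<^sup>2 + q \<kappa> t * (u t)\<^sup>2) (at t)" for t
      using s unfolding ode_sol_def
      by (auto intro!: derivative_eq_intros simp: power2_eq_square algebra_simps)
    show "0 \<le> (v t)\<^sup>2 + q \<kappa> t * (u t)\<^sup>2" for t using qpos[of t] by simp
  qed (simp add: p)
  moreover have "q \<kappa> x * (u x)\<^sup>2 > 0" using qpos x by simp
  ultimately show False by (smt (verit) zero_le_power2)
qed

text \<open>A chain of monotonicity arguments: \<phi> \<phi>' is nondecreasing from 0, so \<phi>^2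
  >= 1, and continuity keeps \<phi> >= 1. By the Wronskian \<psi>/\<phi> has derivative 1/\<phi>^2,
  so \<psi> >= 0; then \<psi>'' = q \<psi> >= 0 gives \<psi>' >= 1. At \<kappa> = m this yields
  \<open>D m \<ge> 2\<close> and rules out zeros of \<psi> on (0, 1].\<close>

lemma nonneg_q_solutions:
  assumes qnn: "\<And>t. q \<kappa> t \<ge> 0" and T: "T \<ge> 0"
  shows "\<phi> \<kappa> T \<ge> 1" "\<psi>' \<kappa> T \<ge> 1" "\<psi> \<kappa> T \<ge> T"
proof -
  have prod: "\<phi> \<kappa> t * \<phi>' \<kappa> t \<ge> 0" if "t \<ge> 0" for t
  proof -
    have "\<phi> \<kappa> 0 * \<phi>' \<kappa> 0 \<le> \<phi> \<kappa> t * \<phi>' \<kappa> t"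
    proof (rule DERIV_nonneg_imp_nondecreasing[OF that])
      fix x :: real
      have "((\<lambda>t. \<phi> \<kappa> t * \<phi>' \<kappa> t) has_real_derivative (\<phi>' \<kappa> x)\<^sup>2 + q \<kappa> x * (\<phi> \<kappa> x)\<^sup>2) (at x)"
        by (auto intro!: derivative_eq_intros fund_deriv simp: power2_eq_square algebra_simps)
      then show "\<exists>y. ((\<lambda>t. \<phi> \<kappa> t * \<phi>' \<kappa> t) has_real_derivative y) (at x) \<and> 0 \<le> y"
        using qnn[of x] by (intro exI[of _ "(\<phi>' \<kappa> x)\<^sup>2 + q \<kappa> x * (\<phi> \<kappa> x)\<^sup>2"] conjI) auto
    qed
    then show ?thesis by (simp add: fund)
  qed
  have sq: "(\<phi> \<kappa> t)\<^sup>2 \<ge> 1" if "t \<ge> 0" for t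
  proof -
    have "(\<phi> \<kappa> 0)\<^sup>2 \<le> (\<phi> \<kappa> t)\<^sup>2"
    proof (rule DERIV_nonneg_imp_nondecreasing[OF that])
      fix x :: real assume x: "0 \<le> x"
      have "((\<lambda>t. (\<phi> \<kappa> t)\<^sup>2) has_real_derivative 2 * (\<phi> \<kappa> x * \<phi>' \<kappa> x)) (at x)"
        by (auto intro!: derivative_eq_intros fund_deriv)
      then show "\<exists>y. ((\<lambda>t. (\<phi> \<kappa> t)\<^sup>2) has_real_derivative y) (at x) \<and> 0 \<le> y"
        using prod[OF x] by (intro exI[of _ "2 * (\<phi> \<kappa> x * \<phi>' \<kappa> x)"] conjI) auto
    qed
    then show ?thesis by (simp add: fund)
  qed
  have phi: "\<phi> \<kappa> t \<ge> 1" if t: "t \<ge> 0" for t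
  proof (rule ccontr)
    assume "\<not> \<phi> \<kappa> t \<ge> 1"
    then have "\<phi> \<kappa> t \<le> 0" using sq[OF t] abs_square_less_1[of "\<phi> \<kappa> t"] by linarith
    then obtain x where "0 \<le> x" "\<phi> \<kappa> x = 0"
      using IVT2'[of "\<phi> \<kappa>" t 0 0] t fund_continuous by (auto simp: fund)
    then show False using sq[of x] by simp
  qed
  have psi: "\<psi> \<kappa> t \<ge> 0" if t: "t \<ge> 0" for t
  proof -
    have "\<psi> \<kappa> 0 / \<phi> \<kappa> 0 \<le> \<psi> \<kappa> t / \<phi> \<kappa> t"
    proof (rule DERIV_nonneg_imp_nondecreasing[OF t])
      fix x :: real assume x: "0 \<le> x"
      have "((\<lambda>t. \<psi> \<kappa> t / \<phi> \<kappa> t) has_real_derivative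
          (\<psi>' \<kappa> x * \<phi> \<kappa> x - \<psi> \<kappa> x * \<phi>' \<kappa> x) / (\<phi> \<kappa> x * \<phi> \<kappa> x)) (at x)"
        using phi[OF x] by (intro DERIV_divide fund_deriv) auto
      moreover have "\<psi>' \<kappa> x * \<phi> \<kappa> x - \<psi> \<kappa> x * \<phi>' \<kappa> x = 1"
        using wronskian[of \<kappa> x] by (simp add: algebra_simps)
      ultimately show "\<exists>y. ((\<lambda>t. \<psi> \<kappa> t / \<phi> \<kappa> t) has_real_derivative y) (at x) \<and> 0 \<le> y"
        by (intro exI conjI) auto
    qed
    then show ?thesis using phi[OF t] by (simp add: fund zero_le_divide_iff)
  qed
  have psi': "\<psi>' \<kappa> t \<ge> 1" if t: "t \<ge> 0" for t
  proof -
    have "\<psi>' \<kappa> 0 \<le> \<psi>' \<kappa> t"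
      by (rule DERIV_nonneg_imp_nondecreasing[OF t])
        (use fund_deriv(2) psi qnn in \<open>blast intro: mult_nonneg_nonneg\<close>)
    then show ?thesis by (simp add: fund)
  qed
  have "\<psi> \<kappa> 0 - 0 \<le> \<psi> \<kappa> T - T"
  proof (rule DERIV_nonneg_imp_nondecreasing[OF T])
    fix x :: real assume x: "0 \<le> x"
    have "((\<lambda>t. \<psi> \<kappa> t - t) has_real_derivative \<psi>' \<kappa> x - 1) (at x)"
      by (auto intro!: derivative_eq_intros fund_deriv)
    then show "\<exists>y. ((\<lambda>t. \<psi> \<kappa> t - t) has_real_derivative y) (at x) \<and> 0 \<le> y"
      using psi'[OF x] by (intro exI conjI) auto
  qed
  then show "\<psi> \<kappa> T \<ge> T" by (simp add: fund)
  show "\<phi> \<kappa> T \<ge> 1" "\<psi>' \<kappa> T \<ge> 1" using phi psi' T by auto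
qed

text \<open>At the supremum \<open>\<kappa>\<close> of the bad parameters \<open>\<psi>\<close> touches zero from above; an interior
  contact point would be a double zero, so the contact is at \<open>1\<close>. There \<open>\<psi> 1 = 0\<close> makes the monodromy
  matrix triangular, with two negative diagonal entries since its determinant is \<open>1\<close>.\<close>

lemma dirichlet_D_negative:
  assumes m: "\<And>t. s t \<le> m * r t" and l0: "\<kappa>0 \<le> m"
    and bad: "0 < t0" "t0 \<le> 1" "\<psi> \<kappa>0 t0 \<le> 0"
  obtains \<kappa> where "\<kappa>0 \<le> \<kappa>" "\<kappa> \<le> m" "D \<kappa> < 0"
proof -
  define Z where "Z = {\<kappa>. \<kappa>0 \<le> \<kappa> \<and> \<kappa> \<le> m \<and> (\<exists>t. 0 < t \<and> t \<le> 1 \<and> \<psi> \<kappa> t \<le> 0)}"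
  have Z: "\<kappa>0 \<in> Z" "bdd_above Z" using l0 bad by (auto simp: Z_def intro!: bdd_aboveI[of _ m])
  define \<kappa> where "\<kappa> = Sup Z"
  have l: "\<kappa>0 \<le> \<kappa>" "\<kappa> \<le> m"
    unfolding \<kappa>_def using Z by (auto intro: cSup_upper cSup_least simp: Z_def)
  have m_pos: "\<psi> m t \<ge> t" if "t \<ge> 0" for t
    using nonneg_q_solutions(3)[of m t] that m by (auto simp: q_def)
  \<comment> \<open>A negative value would persist for slightly larger parameters, which would then
    lie in \<open>Z\<close> above its supremum. There is room below m because \<psi> is nonnegative
    at m.\<close>
  have nn: "\<psi> \<kappa> t \<ge> 0" if t: "0 \<le> t" "t \<le> 1" for t
  proof (rule ccontr)
    assume neg: "\<not> \<psi> \<kappa> t \<ge> 0"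
    then have t0: "t > 0" using t by (cases "t = 0") (auto simp: fund)
    have "\<kappa> \<noteq> m" using neg m_pos[of t] t by auto
    then have lm: "\<kappa> < m" using l by simp
    have "- \<psi> \<kappa> t > 0" using neg by simp
    from fund_close[OF this, of \<kappa> 0 1] obtain d where d: "d > 0"
      "\<And>\<mu>. \<bar>\<mu> - \<kappa>\<bar> < d \<Longrightarrow> \<bar>\<psi> \<mu> t - \<psi> \<kappa> t\<bar> < - \<psi> \<kappa> t" using t by metis
    define \<mu> where "\<mu> = min m (\<kappa> + d / 2)"
    have mu: "\<kappa> < \<mu>" "\<mu> \<le> m" "\<bar>\<mu> - \<kappa>\<bar> < d" using lm d(1) by (auto simp: \<mu>_def)
    have "\<psi> \<mu> t \<le> 0" using d(2)[OF mu(3)] by linarith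
    then have "\<mu> \<in> Z" using mu l t0 t by (auto simp: Z_def)
    then have "\<mu> \<le> \<kappa>" unfolding \<kappa>_def using Z by (intro cSup_upper)
    then show False using mu by simp
  qed
  \<comment> \<open>The supremum belongs to \<open>Z\<close>: otherwise \<psi> would stay positive
    on (0, 1] for all nearby parameters. As \<psi> vanishes at 0, closeness of values settles only
    [k, 1]; on (0, k) closeness of \<psi>' to 1 is used.\<close>
  have "\<exists>t. 0 < t \<and> t \<le> 1 \<and> \<psi> \<kappa> t \<le> 0"
  proof (rule ccontr)
    assume "\<nexists>t. 0 < t \<and> t \<le> 1 \<and> \<psi> \<kappa> t \<le> 0"
    then have pos: "\<psi> \<kappa> t > 0" if "0 < t" "t \<le> 1" for t using that by force
    have "isCont (\<psi>' \<kappa>) 0" using fund_deriv(2) DERIV_isCont by blast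
    then obtain h where h: "h > 0" "\<And>t. \<bar>t\<bar> < h \<Longrightarrow> \<bar>\<psi>' \<kappa> t - 1\<bar> < 1 / 2"
      unfolding continuous_at_eps_delta dist_real_def fund diff_0_right by (metis half_gt_zero zero_less_one)
    define k where "k = min (h / 2) 1"
    have k: "0 < k" "k < h" "k \<le> 1" using h by (auto simp: k_def)
    obtain x where x: "x \<in> {k..1}" "\<And>t. t \<in> {k..1} \<Longrightarrow> \<psi> \<kappa> x \<le> \<psi> \<kappa> t"
      using continuous_attains_inf[of "{k..1}" "\<psi> \<kappa>"] fund_continuous k by auto
    \<comment> \<open>The bound 1/2 keeps \<open>\<psi>' \<mu>\<close> positive near 0, where
      \<open>\<psi>' \<kappa>\<close> exceeds 1/2; the minimum of \<open>\<psi> \<kappa>\<close>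
      keeps \<open>\<psi> \<mu>\<close> positive on [k, 1].\<close>
    define e where "e = min (1 / 2) (\<psi> \<kappa> x)"
    have e: "e > 0" "e \<le> 1 / 2" "e \<le> \<psi> \<kappa> x" using pos[of x] x k by (auto simp: e_def)
    obtain d where d: "d > 0" "\<And>\<mu> t. \<bar>\<mu> - \<kappa>\<bar> < d \<Longrightarrow> 0 \<le> t \<Longrightarrow> t \<le> 1 \<Longrightarrow>
      \<bar>\<psi> \<mu> t - \<psi> \<kappa> t\<bar> < e \<and> \<bar>\<psi>' \<mu> t - \<psi>' \<kappa> t\<bar> < e" using fund_close[OF e(1), of \<kappa> 0 1] by metis
    obtain \<mu> where mu: "\<mu> \<in> Z" "\<kappa> - d < \<mu>" using less_cSup_iff[of Z "\<kappa> - d"] Z d by (auto simp: \<kappa>_def)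
    have "\<mu> \<le> \<kappa>" unfolding \<kappa>_def using Z mu by (intro cSup_upper)
    then have close: "\<bar>\<mu> - \<kappa>\<bar> < d" using mu by simp
    obtain t where t: "0 < t" "t \<le> 1" "\<psi> \<mu> t \<le> 0" using mu by (auto simp: Z_def)
    show False
    proof (cases "t \<ge> k")
      case True
      then show False using x(2)[of t] t d(2)[OF close, of t] e by auto
    next
      case False
      have "\<psi> \<mu> 0 < \<psi> \<mu> t"
      proof (rule DERIV_pos_imp_increasing[OF t(1)])
        fix z assume z: "0 \<le> z" "z \<le> t"
        have "\<psi>' \<mu> z > 0" 
        proof -
          have "\<bar>\<psi>' \<kappa> z - 1\<bar> < 1 / 2" using h(2)[of z] z False k by simp
          moreover have "\<bar>\<psi>' \<mu> z - \<psi>' \<kappa> z\<bar> < e" using d(2)[OF close, of z] z t by simp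
          ultimately show ?thesis using e by linarith
        qed
        then show "\<exists>y. (\<psi> \<mu> has_real_derivative y) (at z) \<and> 0 < y" using fund_deriv(1) by blast
      qed
      then show False using t by (simp add: fund)
    qed
  qed
  then obtain t where t: "0 < t" "t \<le> 1" "\<psi> \<kappa> t = 0"
    using nn by (metis antisym less_imp_le)
  have "t = 1"
  proof (rule ccontr)
    assume "t \<noteq> 1"
    then have "\<psi>' \<kappa> t = 0"
      using t nn by (intro DERIV_local_min[OF fund_deriv(1), of "min t (1 - t)"]) auto
    with t(3) have "\<psi>' \<kappa> 0 = 0" using ode_sol_q_unique_zero[OF fund(1)] by blast
    then show False by (simp add: fund)
  qed
  then have p1: "\<psi> \<kappa> 1 = 0" using t by simp
  have "\<psi>' \<kappa> 1 \<le> 0"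
  proof (rule ccontr)
    assume "\<not> \<psi>' \<kappa> 1 \<le> 0"
    then obtain h where h: "h > 0" "\<And>k. 0 < k \<Longrightarrow> k < h \<Longrightarrow> \<psi> \<kappa> (1 - k) < \<psi> \<kappa> 1"
      using DERIV_pos_inc_left[OF fund_deriv(1)[of 0 1 \<kappa> 1]] by auto
    define k where "k = min (h / 2) 1"
    have "0 < k" "k < h" "k \<le> 1" using h(1) by (auto simp: k_def)
    then show False using h(2)[of k] nn[of "1 - k"] p1 by auto
  qed
  have w: "\<phi> \<kappa> 1 * \<psi>' \<kappa> 1 = 1" using wronskian[of \<kappa> 1] p1 by simp
  with \<open>\<psi>' \<kappa> 1 \<le> 0\<close> have "\<phi> \<kappa> 1 < 0"
    using mult_nonneg_nonpos[of "\<phi> \<kappa> 1" "\<psi>' \<kappa> 1"] by linarith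
  moreover have "\<psi>' \<kappa> 1 \<noteq> 0" using w by auto
  ultimately have "\<phi> \<kappa> 1 < 0" "\<psi>' \<kappa> 1 < 0" using \<open>\<psi>' \<kappa> 1 \<le> 0\<close> by auto
  then show ?thesis using that[OF l] by (simp add: D_def)
qed

text \<open>\<open>D\<close> is negative somewhere in [\<kappa>0, m] and at least 2 at m, so it
  takes the value 2 in between. No solution of D = 2 exceeds m, so those from \<omega> upwards form
  a compact set, whose maximum is the greatest of all.\<close>

lemma greatest_eigenvalue:
  assumes m: "\<And>t. s t \<le> m * r t" and l0: "\<kappa>0 \<le> m"
    and bad: "0 < t0" "t0 \<le> 1" "\<psi> \<kappa>0 t0 \<le> 0"
  obtains \<kappa> where "\<kappa>0 \<le> \<kappa>" "\<kappa> \<le> m" "D \<kappa> = 2" "\<And>\<mu>. D \<mu> = 2 \<Longrightarrow> \<mu> \<le> \<kappa>"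
proof -
  obtain \<nu> where n: "\<kappa>0 \<le> \<nu>" "\<nu> \<le> m" "D \<nu> < 0" by (rule dirichlet_D_negative[OF m l0 bad])
  have "D m \<ge> 2" using nonneg_q_solutions(1,2)[of m 1] m by (auto simp: D_def q_def)
  then obtain \<omega> where k: "\<nu> \<le> \<omega>" "\<omega> \<le> m" "D \<omega> = 2"
    using IVT'[of D \<nu> 2 m] n continuous_on_subset[OF D_continuous] by auto
  let ?S = "{\<omega>..m} \<inter> D -` {2}"
  have "compact ?S"
    by (intro compact_Int_closed continuous_closed_vimage)
      (use D_continuous in \<open>auto simp: continuous_on_eq_continuous_at\<close>)
  then obtain \<kappa> where l: "\<kappa> \<in> ?S" "\<And>\<mu>. \<mu> \<in> ?S \<Longrightarrow> \<mu> \<le> \<kappa>"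
    using compact_attains_sup[of ?S] k by (metis IntI atLeastAtMost_iff empty_iff order_refl vimage_singleton_eq)
  have "\<mu> \<le> \<kappa>" if "D \<mu> = 2" for \<mu>
    using l(1) l(2)[of \<mu>] D_eq_2_bound[OF m that] that by (cases "\<omega> \<le> \<mu>") auto
  then show ?thesis using that[of \<kappa>] l(1) n(1) k(1) by auto
qed

end

section \<open>The operator on the circle\<close>

lemma circle_of_add_one: "circle_of (t + 1) = circle_of t"
  by (simp add: circle_of_eq_iff)

lemma circle_of_rep: "circle_of (rep_circle p) = p"
  using Quotient3_abs_rep[OF Quotient3_circle] .

lemma circle_of_frac: "circle_of (frac t) = circle_of t"
  by (simp add: circle_of_eq_iff frac_def)

lemma circle_of_cases: obtains t where "0 \<le> t" "t < 1" "p = circle_of t"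
  using that[of "frac (rep_circle p)"] by (simp add: circle_of_frac circle_of_rep frac_lt_1)

text \<open>The chosen representative differs from t by an integer. Hence composing a periodic
  function with \<open>rep_circle\<close> gives a function on the circle whose lift is the original
  one.\<close>

lemma periodic_circle_lift:
  fixes u :: "real \<Rightarrow> 'a"
  assumes "\<And>t. u (t + 1) = u t"
  shows "u (rep_circle (circle_of t)) = u t"
proof -
  have "rep_circle (circle_of t) - t \<in> \<int>" using circle_of_eq_iff circle_of_rep by metis
  then obtain k where "rep_circle (circle_of t) = t + of_int k"
    by (metis Ints_cases add.commute diff_add_cancel)
  then show ?thesis using periodic_add_of_int[of u t k, OF assms] by simp
qed

text \<open>The circle is the image of [0, 1], so the extreme value theorem there suffices.\<close>

lemma continuous_circle_attains_sup:
  fixes f :: "circle \<Rightarrow> real"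
  assumes "continuous_on UNIV f"
  obtains p where "\<And>x. f x \<le> f p"
proof -
  have "continuous_on {0..1} (\<lambda>t. f (circle_of t))"
    using assms continuous_on_subset unfolding continuous_on_circle_iff by blast
  then have "\<exists>t\<in>{0..1}. \<forall>x\<in>{0..1}. f (circle_of x) \<le> f (circle_of t)"
    by (intro continuous_attains_sup) auto
  then obtain t where t: "\<And>x. x \<in> {0..1} \<Longrightarrow> f (circle_of x) \<le> f (circle_of t)" by blast
  have "f x \<le> f (circle_of t)" for x
    by (rule circle_of_cases[of x]) (simp add: t)
  then show ?thesis by (rule that)
qed

lemma has_circle_derivative_Re_Im:
  fixes f :: "circle \<Rightarrow> complex"
  assumes "has_circle_derivative f f'"
  shows "((\<lambda>s. Re (f (circle_of s))) has_real_derivative Re (f' (circle_of t))) (at t)"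
    and "((\<lambda>s. Im (f (circle_of s))) has_real_derivative Im (f' (circle_of t))) (at t)"
proof -
  have "((\<lambda>s. f (circle_of s)) has_vector_derivative f' (circle_of t)) (at t)"
    using assms by (simp add: has_circle_derivative_def)
  from bounded_linear.has_vector_derivative[OF bounded_linear_Re this]
    bounded_linear.has_vector_derivative[OF bounded_linear_Im this]
  show "((\<lambda>s. Re (f (circle_of s))) has_real_derivative Re (f' (circle_of t))) (at t)"
    "((\<lambda>s. Im (f (circle_of s))) has_real_derivative Im (f' (circle_of t))) (at t)"
    by (simp_all only: has_real_derivative_iff_has_vector_derivative)
qed

section \<open>Reduction of the eigenvalue problem to Hill's equation\<close>

locale circle_operator =
  fixes a c :: "circle \<Rightarrow> real" and \<epsilon> :: real
  assumes a_cont: "continuous_on UNIV a" and a_pos: "\<And>p. a p > 0"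
    and c_cont: "continuous_on UNIV c" and \<epsilon>_pos: "\<epsilon> > 0"
begin

sublocale hill: hill_equation "\<lambda>t. 1 / (\<epsilon> * a (circle_of t))" "\<lambda>t. c (circle_of t) / (\<epsilon> * a (circle_of t))"
proof
  have nz: "\<epsilon> * a p \<noteq> 0" for p using a_pos[of p] \<epsilon>_pos by simp
  have ac: "continuous_on UNIV (\<lambda>t. a (circle_of t))" "continuous_on UNIV (\<lambda>t. c (circle_of t))"
    using a_cont c_cont by (simp_all only: continuous_on_circle_iff)
  show "continuous_on UNIV (\<lambda>t. 1 / (\<epsilon> * a (circle_of t)))"
    "continuous_on UNIV (\<lambda>t. c (circle_of t) / (\<epsilon> * a (circle_of t)))"
    by (intro continuous_intros ac; use nz in blast)+
  show "1 / (\<epsilon> * a (circle_of t)) > 0" for t using a_pos \<epsilon>_pos by simp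
qed (simp_all add: circle_of_add_one)

lemma q_eq: "hill.q \<kappa> t = (\<kappa> - c (circle_of t)) / (\<epsilon> * a (circle_of t))"
  by (simp add: hill.q_def diff_divide_distrib)

lemma eigenfunction_components:
  assumes eq: "complex_of_real (\<epsilon> * a p) * w + complex_of_real (c p) * u = z * u"
  shows "Re w = ((Re z - c p) * Re u - Im z * Im u) / (\<epsilon> * a p)"
    and "Im w = ((Re z - c p) * Im u + Im z * Re u) / (\<epsilon> * a p)"
proof -
  have nz: "\<epsilon> * a p \<noteq> 0" using a_pos[of p] \<epsilon>_pos by simp
  have "\<epsilon> * a p * Re w = (Re z - c p) * Re u - Im z * Im u"
    "\<epsilon> * a p * Im w = (Re z - c p) * Im u + Im z * Re u"
    using arg_cong[OF eq, of Re] arg_cong[OF eq, of Im] by (simp_all add: algebra_simps)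
  then show "Re w = ((Re z - c p) * Re u - Im z * Im u) / (\<epsilon> * a p)"
    "Im w = ((Re z - c p) * Im u + Im z * Re u) / (\<epsilon> * a p)"
    by (simp_all only: nonzero_eq_divide_eq[OF nz] mult.commute)
qed

text \<open>Self-adjointness forces z to be real; then the real and imaginary parts of an
  eigenfunction are periodic solutions of Hill's equation and one of them is nonzero. Conversely, a
  periodic solution descends to the circle.\<close>

lemma is_eigenvalue_iff: "is_eigenvalue a c \<epsilon> z \<longleftrightarrow> Im z = 0 \<and> hill.D (Re z) = 2"
proof
  assume "is_eigenvalue a c \<epsilon> z"
  then obtain u u' u'' p where d: "has_circle_derivative u u'" "has_circle_derivative u' u''"
    and nz: "u p \<noteq> 0" and eq: "\<And>p. complex_of_real (\<epsilon> * a p) * u'' p + complex_of_real (c p) * u p = z * u p"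
    unfolding is_eigenvalue_def has_C2_derivatives_def by blast
  define X Y X' Y' where "X t = Re (u (circle_of t))" and "Y t = Im (u (circle_of t))"
    and "X' t = Re (u' (circle_of t))" and "Y' t = Im (u' (circle_of t))" for t
  note per = circle_of_add_one
  let ?r = "\<lambda>t. \<epsilon> * a (circle_of t)"
  have r: "?r t > 0" for t using a_pos \<epsilon>_pos by simp
  have dX: "(X has_real_derivative X' t) (at t)" and dY: "(Y has_real_derivative Y' t) (at t)" for t
    unfolding X_def[abs_def] Y_def[abs_def] X'_def Y'_def
    by (rule has_circle_derivative_Re_Im[OF d(1)])+
  have dX': "(X' has_real_derivative ((Re z - c (circle_of t)) * X t - Im z * Y t) / ?r t) (at t)"
    and dY': "(Y' has_real_derivative ((Re z - c (circle_of t)) * Y t + Im z * X t) / ?r t) (at t)" for t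
    using has_circle_derivative_Re_Im[OF d(2), of t] eigenfunction_components[OF eq, of "circle_of t"]
    unfolding X_def Y_def X'_def[abs_def] Y'_def[abs_def] by simp_all
  obtain t0 where t0: "p = circle_of t0" by (rule circle_of_cases)
  have XY: "X t0 \<noteq> 0 \<or> Y t0 \<noteq> 0" using nz t0 by (auto simp: X_def Y_def complex_eq_iff)
  \<comment> \<open>self-adjointness: \<open>Im z\<close> times the Wronskian of \<open>X\<close> and \<open>Y\<close> is periodic and nondecreasing\<close>
  have "(Im z)\<^sup>2 * ((X t0)\<^sup>2 + (Y t0)\<^sup>2) / ?r t0 = 0"
  proof (rule monotone_periodic_deriv_zero[of "\<lambda>t. Im z * (X t * Y' t - Y t * X' t)"
        "\<lambda>t. (Im z)\<^sup>2 * ((X t)\<^sup>2 + (Y t)\<^sup>2) / ?r t"])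
    show "((\<lambda>t. Im z * (X t * Y' t - Y t * X' t)) has_real_derivative
        (Im z)\<^sup>2 * ((X t)\<^sup>2 + (Y t)\<^sup>2) / ?r t) (at t)" for t
    proof -
      let ?C = "Re z - c (circle_of t)"
      have "((\<lambda>t. Im z * (X t * Y' t - Y t * X' t)) has_real_derivative
        Im z * ((X' t * Y' t + ((?C * Y t + Im z * X t) / ?r t) * X t) -
          (Y' t * X' t + ((?C * X t - Im z * Y t) / ?r t) * Y t))) (at t)"
        by (intro DERIV_cmult DERIV_diff DERIV_mult dX dY dX' dY')
      moreover have "i * ((b + ((C * y + i * x) / R) * x) - (b + ((C * x - i * y) / R) * y))
          = i\<^sup>2 * (x\<^sup>2 + y\<^sup>2) / R" for i b C x y R :: real
        by (simp add: field_simps power2_eq_square add_divide_distrib diff_divide_distrib)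
      ultimately show ?thesis by (simp only: mult.commute[of "Y' t" "X' t"])
    qed
    show "0 \<le> (Im z)\<^sup>2 * ((X t)\<^sup>2 + (Y t)\<^sup>2) / ?r t" for t using r[of t] by simp
  qed (simp add: X_def Y_def X'_def Y'_def per)
  then have Im: "Im z = 0" using r[of t0] XY by (auto simp: sum_power2_eq_zero_iff)
  have "ode_sol (hill.q (Re z)) X X'" "ode_sol (hill.q (Re z)) Y Y'"
    using dX dY dX' dY' unfolding ode_sol_def by (simp_all add: q_eq Im)
  moreover have "X (t + 1) = X t" "Y (t + 1) = Y t" for t by (simp_all add: X_def Y_def per)
  ultimately have "hill.D (Re z) = 2" using hill.periodic_solution_D XY by blast
  with Im show "Im z = 0 \<and> hill.D (Re z) = 2" ..
next
  assume z: "Im z = 0 \<and> hill.D (Re z) = 2"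
  then obtain u v x where s: "ode_sol (hill.q (Re z)) u v"
    and p: "\<And>t. u (t + 1) = u t" "\<And>t. v (t + 1) = v t" and nz: "u x \<noteq> 0"
    using hill.D_periodic_solution[OF conjunct2[OF z]] by blast
  \<comment> \<open>\<open>f\<close> descends periodic functions to the circle. The second
    derivative of the eigenfunction is \<open>f ?w\<close>, read off from the equation, so its
    continuity follows from that of q and u.\<close>
  define f where "f w p = complex_of_real (w (rep_circle p))" for w :: "real \<Rightarrow> real" and p
  let ?w = "\<lambda>t. hill.q (Re z) t * u t"
  have pw: "?w (t + 1) = ?w t" for t by (simp add: q_eq p circle_of_add_one)
  have f: "f w (circle_of t) = w t" if "\<And>t. w (t + 1) = w t" for w t
    unfolding f_def by (simp add: periodic_circle_lift[of w, OF that])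
  have d: "has_circle_derivative (f g) (f h)"
    if "\<And>t. (g has_real_derivative h t) (at t)" "\<And>t. g (t + 1) = g t" "\<And>t. h (t + 1) = h t" for g h
    unfolding has_circle_derivative_def f[of g, OF that(2)] f[of h, OF that(3)]
    using that(1) by (auto intro!: has_vector_derivative_of_real simp: has_real_derivative_iff_has_vector_derivative)
  have "has_circle_derivative (f u) (f v)" "has_circle_derivative (f v) (f ?w)"
    using s unfolding ode_sol_def by (intro d p pw; blast)+
  moreover have "continuous_on UNIV (f ?w)"
  proof -
    have "continuous_on UNIV u"
      using s unfolding ode_sol_def by (meson DERIV_isCont continuous_at_imp_continuous_on)
    then have "continuous_on UNIV ?w"
      unfolding hill.q_def 
      by (intro continuous_on_mult continuous_on_diff continuous_on_const hill.cont)
    then show ?thesis unfolding continuous_on_circle_iff f[of ?w, OF pw] by (intro continuous_on_of_real)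
  qed
  moreover have "f u (circle_of x) \<noteq> 0" using nz by (simp add: f[of u, OF p(1)])
  moreover have "complex_of_real (\<epsilon> * a y) * f ?w y + complex_of_real (c y) * f u y = z * f u y" for y
  proof (rule circle_of_cases[of y])
    fix t assume t: "y = circle_of t"
    have "\<epsilon> * a y * ?w t + c y * u t = Re z * u t"
      using a_pos[of y] \<epsilon>_pos by (simp add: q_eq t field_simps)
    then have "complex_of_real (\<epsilon> * a y * ?w t + c y * u t) = complex_of_real (Re z) * complex_of_real (u t)"
      by simp
    moreover have "complex_of_real (Re z) = z" using z by (simp add: complex_eq_iff)
    ultimately show ?thesis by (simp only: t f[of u, OF p(1)] f[of ?w, OF pw] of_real_add of_real_mult)
  qed
  ultimately show "is_eigenvalue a c \<epsilon> z"
    unfolding is_eigenvalue_def has_C2_derivatives_def by blast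
qed

text \<open>Sturm comparison makes \<psi> nonpositive somewhere in [x, y], which lies in (0, 1];
  this is the input of \<open>greatest_eigenvalue\<close>. Since all eigenvalues are real, the
  greatest one is the only number matching the \<open>THE\<close> description.\<close>

lemma principal_eigenvalue_bounds:
  assumes m: "\<And>p. c p \<le> m" and k: "\<kappa> \<le> m" and xy: "0 < x" "x < y" "y \<le> 1"
    and low: "\<And>t. x \<le> t \<Longrightarrow> t \<le> y \<Longrightarrow> hill.q \<kappa> t \<le> - (pi / (y - x))\<^sup>2"
  shows "\<kappa> \<le> Re (principal_eigenvalue a c \<epsilon>)" "Re (principal_eigenvalue a c \<epsilon>) \<le> m"
proof -
  obtain t where t: "x \<le> t" "t \<le> y" "hill.\<psi> \<kappa> t \<le> 0"
    using sturm_positive_solution[OF hill.fund(1) xy(2) low] by (meson not_le)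
  have m': "c (circle_of t) / (\<epsilon> * a (circle_of t)) \<le> m * (1 / (\<epsilon> * a (circle_of t)))" for t
    using m[of "circle_of t"] a_pos[of "circle_of t"] \<epsilon>_pos by (simp add: divide_right_mono)
  obtain l1 where l: "\<kappa> \<le> l1" "l1 \<le> m" "hill.D l1 = 2" "\<And>\<mu>. hill.D \<mu> = 2 \<Longrightarrow> \<mu> \<le> l1"
    by (rule hill.greatest_eigenvalue[OF m' k _ _ t(3)]) (use t xy in auto)
  have "principal_eigenvalue a c \<epsilon> = complex_of_real l1"
    unfolding principal_eigenvalue_def is_eigenvalue_iff
  proof (rule the_equality)
    fix z assume z: "(Im z = 0 \<and> hill.D (Re z) = 2) \<and>
      (\<forall>w. Im w = 0 \<and> hill.D (Re w) = 2 \<longrightarrow> Re w \<le> Re z)"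
    then have "l1 \<le> Re z" using l(3) by (metis Im_complex_of_real Re_complex_of_real)
    with l(4)[of "Re z"] z show "z = complex_of_real l1" by (simp add: complex_eq_iff)
  qed (use l in auto)
  then show "\<kappa> \<le> Re (principal_eigenvalue a c \<epsilon>)" "Re (principal_eigenvalue a c \<epsilon>) \<le> m"
    using l by auto
qed

end

section \<open>The limit of vanishing \<epsilon> and the functional J\<close>

lemma Lambda_eq_maximum:
  assumes a: "continuous_on UNIV a" "\<And>p. a p > 0" and c: "continuous_on UNIV c"
    and m: "\<And>p. c p \<le> c p0"
  shows "Lambda a c = c p0"
proof -
  obtain pA where A: "\<And>p. a p \<le> a pA" using continuous_circle_attains_sup[OF a(1)] by blast
  let ?A = "a pA" and ?m = "c p0"
  \<comment> \<open>On a fixed interval near the maximum point, c exceeds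
    \<open>?m - \<delta>\<close> by at least \<delta>/2. There the coefficient q at
    \<open>?m - \<delta>\<close> is at most - \<delta> / (2 \<epsilon> a), which falls below the
    Sturm threshold for small \<epsilon>.\<close>
  have "((\<lambda>\<epsilon>. Re (principal_eigenvalue a c \<epsilon>)) \<longlongrightarrow> ?m) (at_right 0)"
  proof (rule tendstoI)
    fix e :: real assume e: "e > 0"
    define \<delta> where "\<delta> = e / 2"
    have d: "\<delta> > 0" "\<delta> < e" using e by (auto simp: \<delta>_def)
    obtain t0 where t0: "0 \<le> t0" "t0 < 1" "p0 = circle_of t0" by (rule circle_of_cases)
    have "isCont (\<lambda>t. c (circle_of t)) t0"
      using c unfolding continuous_on_circle_iff by (simp add: continuous_on_eq_continuous_at)
    then obtain h where h: "h > 0" "\<And>t. \<bar>t - t0\<bar> < h \<Longrightarrow> \<bar>c (circle_of t) - ?m\<bar> < \<delta> / 2"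
      unfolding continuous_at_eps_delta dist_real_def t0(3) using d(1) by (metis half_gt_zero)
    \<comment> \<open>The interval [x, y] starts at distance k/2 to the right of \<open>t0\<close>,
      so x > 0 even if \<open>t0\<close> is 0; the bound 1 - \<open>t0\<close> ensures y <=
      1.\<close>
    define k where "k = min (h / 2) (1 - t0)"
    define x y where "x = t0 + k / 2" and "y = t0 + k"
    have k: "0 < k" "k < h" "k \<le> 1 - t0" using h t0 by (auto simp: k_def)
    have xy: "0 < x" "x < y" "y \<le> 1" using k t0 by (auto simp: x_def y_def)
    have cxy: "c (circle_of t) \<ge> ?m - \<delta> / 2" if "x \<le> t" "t \<le> y" for t
    proof -
      have "\<bar>t - t0\<bar> < h" using that k by (auto simp: x_def y_def)
      from h(2)[OF this] show ?thesis by linarith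
    qed
    define L where "L = (pi / (y - x))\<^sup>2"
    have L: "L > 0" using xy by (simp add: L_def)
    \<comment> \<open>Chosen so that \<open>L * \<epsilon> * a\<close> is at most \<delta>/2 on the
      whole circle for \<epsilon> < \<open>\<epsilon>0\<close>, as \<open>?A\<close> is the maximum
      of a.\<close>
    define \<epsilon>0 where "\<epsilon>0 = \<delta> / 2 / (L * ?A)"
    have e0: "\<epsilon>0 > 0" unfolding \<epsilon>0_def using d L a(2) by (intro divide_pos_pos mult_pos_pos) auto
    have "dist (Re (principal_eigenvalue a c \<epsilon>)) ?m < e" if eps: "0 < \<epsilon>" "\<epsilon> < \<epsilon>0" for \<epsilon>
    proof -
      interpret circle_operator a c \<epsilon> using a c eps by unfold_locales auto
      have "hill.q (?m - \<delta>) t \<le> - L" if t: "x \<le> t" "t \<le> y" for t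
      proof -
        let ?r = "\<epsilon> * a (circle_of t)"
        have r: "?r > 0" using eps a(2) by simp
        have "L * ?r \<le> L * (\<epsilon>0 * ?A)"
          using eps A[of "circle_of t"] a(2) L e0 by (intro mult_left_mono mult_mono) (auto simp: less_imp_le)
        also have "\<dots> = \<delta> / 2" using L a(2)[of pA] by (simp add: \<epsilon>0_def)
        finally have "?m - \<delta> - c (circle_of t) \<le> - L * ?r" using cxy[OF t] by simp
        then show ?thesis using r by (simp add: q_eq divide_le_eq)
      qed
      then have "?m - \<delta> \<le> Re (principal_eigenvalue a c \<epsilon>)" "Re (principal_eigenvalue a c \<epsilon>) \<le> ?m"
        using principal_eigenvalue_bounds[OF m _ xy, of "?m - \<delta>"] d by (auto simp: L_def)
      then show ?thesis using d by (simp add: dist_real_def)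
    qed
    then show "\<forall>\<^sub>F \<epsilon> in at_right 0. dist (Re (principal_eigenvalue a c \<epsilon>)) ?m < e"
      using e0 unfolding eventually_at_right_field by blast
  qed
  then show ?thesis unfolding Lambda_def by (intro tendsto_Lim) auto
qed

theorem proposition2p2:
  fixes a :: "circle \<Rightarrow> real" and \<mu> :: "circle measure"
  assumes "C2_circle a" and "\<And>p. a p > 0"
    and "prob_space \<mu>" and "sets \<mu> = sets borel"
  shows "J a \<mu> = 0"
proof -
  interpret prob_space \<mu> by fact
  obtain a' where "has_circle_derivative a a'"
    using assms(1) unfolding C2_circle_def has_C2_derivatives_def by blast
  then have a: "continuous_on UNIV a"
    unfolding continuous_on_circle_iff has_circle_derivative_def
    by (auto intro: continuous_at_imp_continuous_on has_vector_derivative_continuous)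
  \<comment> \<open>A mean with respect to a probability measure is at most the maximum, which is
    \<Lambda>(c). The minimum \<open>c p1\<close> serves only to bound |c| for
    integrability.\<close>
  have le: "(\<integral>p. c p \<partial>\<mu>) - Lambda a c \<le> 0" if c: "continuous_on UNIV c" for c
  proof -
    obtain p0 where p0: "\<And>p. c p \<le> c p0" using continuous_circle_attains_sup[OF c] by blast
    have "continuous_on UNIV (\<lambda>p. - c p)" using c by (intro continuous_intros)
    then obtain p1 where "\<And>p. - c p \<le> - c p1" using continuous_circle_attains_sup by blast
    then have p1: "c p1 \<le> c p" for p by simp
    have "integrable \<mu> c"
    proof (rule integrable_const_bound)
      have "measurable \<mu> borel = measurable borel (borel :: real measure)"
        by (rule measurable_cong_sets) (simp_all add: assms(4))
      then show "c \<in> borel_measurable \<mu>" using borel_measurable_continuous_onI[OF c] by simp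
      show "AE p in \<mu>. norm (c p) \<le> max \<bar>c p0\<bar> \<bar>c p1\<bar>"
      proof (rule AE_I2)
        show "norm (c p) \<le> max \<bar>c p0\<bar> \<bar>c p1\<bar>" for p using p0[of p] p1[of p] by auto
      qed
    qed
    then have "(\<integral>p. c p \<partial>\<mu>) \<le> c p0" by (intro integral_le_const) (auto simp: p0)
    then show ?thesis using Lambda_eq_maximum[OF a assms(2) c p0] by simp
  qed
  \<comment> \<open>The competitor c = 0 attains the value 0 in the supremum.\<close>
  have "Lambda a (\<lambda>_. 0) = 0"
    using Lambda_eq_maximum[OF a assms(2), of "\<lambda>_. 0"] by simp
  then have "ereal ((\<integral>p. 0 \<partial>\<mu>) - Lambda a (\<lambda>_. 0)) = 0" by (simp add: zero_ereal_def)
  then have "0 \<le> J a \<mu>"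
    unfolding J_def by (intro SUP_upper2[of "\<lambda>_. 0"]) auto
  moreover have "J a \<mu> \<le> 0"
    unfolding J_def using le by (intro SUP_least) (simp add: zero_ereal_def)
  ultimately show ?thesis by (rule antisym[rotated])
qed

end
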